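(* Let $X\subseteq T^n$ be a closed subvariety, and let $\varphi:T^m\dashrightarrow X\subseteq T^n$ and $\alpha_i:T^{p_i}\dashrightarrow T^m$ for $i=1,2$ be dominant rational maps. Then there exists a dominant rational map $\alpha:T^{p_1+p_2+1}\dashrightarrow T^m$ such that $\operatorname{im}\operatorname{Trop}(\varphi\circ\alpha)$ contains both $\operatorname{im}\operatorname{Trop}(\varphi\circ\alpha_1)$ and $\operatorname{im}\operatorname{Trop}(\varphi\circ\alpha_2)$.
   Context: $K$ is an algebraically closed field with a non-Archimedean valuation $v:K\to\mathbb{R}\cup\{\infty\}$ (possibly trivial). Write $T=K^*$ for the one-dimensional torus over $K$ and $T^n$ for the $n$-dimensional torus. For a non-zero polynomial $f=\sum_\alpha c_\alpha x^\alpha \in K[x_1,\ldots,x_m]$, $\operatorname{Trop}(f):\mathbb{R}^m\to\mathbb{R}$ is the function $\operatorname{Trop}(f)(\xi)=\min_\alpha (v(c_\alpha)+\xi\cdot\alpha)$. It extends to non-zero rational functions by $\operatorname{Trop}(f/h)=\operatorname{Trop}(f)-\operatorname{Trop}(h)$. For a rational map $\varphi=(f_1,\ldots,f_n):T^m\dashrightarrow T^n$ (each $f_i$ a non-zero rational function) set $\operatorname{Trop}(\varphi)=(\operatorname{Trop}(f_1),\ldots,\operatorname{Trop}(f_n)):\mathbb{R}^m\to\mathbb{R}^n$. *)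

theory Defs
  imports
    "HOL-Library.Poly_Mapping"
    "HOL-Library.FuncSet"
    "HOL-Library.Extended_Real"
    "HOL-Computational_Algebra.Polynomial"
    "HOL-Computational_Algebra.Fraction_Field"
begin

text \<open>
  The variables are \<open>x_0, x_1, \<dots>\<close>, indexed by \<open>nat\<close>.  \<open>K[x_0, \<dots>, x_(m-1)]\<close> is the set
  \<open>polys m\<close> of the polynomials with exponent vectors supported on \<open>{..<m}\<close>.  Rational functions
  live in the fraction field of the polynomial ring in all variables; those in \<open>m\<close> variables
  are the quotients of elements of \<open>polys m\<close>.  An \<open>m\<close>-tuple is an extensional function on
  \<open>{..<m}\<close>.
\<close>

type_synonym 'k mpoly = "(nat \<Rightarrow>\<^sub>0 nat) \<Rightarrow>\<^sub>0 'k"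
type_synonym 'k ratfun = "'k mpoly fract"

definition valuation :: "('k::field \<Rightarrow> ereal) \<Rightarrow> bool" where
  "valuation v \<longleftrightarrow>
     (\<forall>x. v x \<noteq> -\<infinity>) \<and>
     (\<forall>x. v x = \<infinity> \<longleftrightarrow> x = 0) \<and>
     (\<forall>x y. v (x * y) = v x + v y) \<and>
     (\<forall>x y. min (v x) (v y) \<le> v (x + y))"

definition polys :: "nat \<Rightarrow> ('k::field) mpoly set" where
  "polys m = {p. \<forall>\<alpha> \<in> Poly_Mapping.keys p. Poly_Mapping.keys \<alpha> \<subseteq> {..<m}}"

text \<open>Evaluation at \<open>x\<close>, with the coefficients mapped along \<open>h\<close>.\<close>

definition eval_with :: "('k::field \<Rightarrow> 'r::comm_semiring_1) \<Rightarrow> (nat \<Rightarrow> 'r) \<Rightarrow> 'k mpoly \<Rightarrow> 'r" where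
  "eval_with h x p =
     (\<Sum>\<alpha>\<in>Poly_Mapping.keys p.
        h (Poly_Mapping.lookup p \<alpha>) * (\<Prod>i\<in>Poly_Mapping.keys \<alpha>. x i ^ Poly_Mapping.lookup \<alpha> i))"

abbreviation eval_poly :: "(nat \<Rightarrow> 'k::field) \<Rightarrow> 'k mpoly \<Rightarrow> 'k" where
  "eval_poly \<equiv> eval_with (\<lambda>c. c)"

definition const_rat :: "'k::field \<Rightarrow> 'k ratfun" where
  "const_rat c = Fract (Poly_Mapping.single 0 c) 1"

abbreviation subst_poly :: "(nat \<Rightarrow> ('k::field) ratfun) \<Rightarrow> 'k mpoly \<Rightarrow> 'k ratfun" where
  "subst_poly \<equiv> eval_with const_rat"

definition is_quotient :: "nat \<Rightarrow> ('k::field) ratfun \<Rightarrow> 'k mpoly \<Rightarrow> 'k mpoly \<Rightarrow> bool" where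
  "is_quotient m f a b \<longleftrightarrow> a \<in> polys m \<and> b \<in> polys m \<and> b \<noteq> 0 \<and> f = Fract a b"

definition ratfuns :: "nat \<Rightarrow> ('k::field) ratfun set" where
  "ratfuns m = {f. \<exists>a b. is_quotient m f a b}"

definition torus :: "nat \<Rightarrow> (nat \<Rightarrow> 'k::field) set" where
  "torus n = {..<n} \<rightarrow>\<^sub>E (UNIV - {0})"

text \<open>
  Every Laurent polynomial is a polynomial times a monomial that is a unit on the torus, so
  ordinary polynomials define the Zariski topology of the torus.
\<close>

definition zariski_closed :: "nat \<Rightarrow> (nat \<Rightarrow> 'k::field) set \<Rightarrow> bool" where
  "zariski_closed n X \<longleftrightarrow> (\<exists>S \<subseteq> polys n. X = {x \<in> torus n. \<forall>p\<in>S. eval_poly x p = 0})"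

definition zariski_closure :: "nat \<Rightarrow> (nat \<Rightarrow> 'k::field) set \<Rightarrow> (nat \<Rightarrow> 'k) set" where
  "zariski_closure n A =
     {x \<in> torus n. \<forall>p\<in>polys n. (\<forall>a\<in>A. eval_poly a p = 0) \<longrightarrow> eval_poly x p = 0}"

text \<open>The rational function \<open>f\<close> in \<open>m\<close> variables is defined at \<open>x\<close> and has the value \<open>y\<close> there.\<close>

definition has_value :: "nat \<Rightarrow> ('k::field) ratfun \<Rightarrow> (nat \<Rightarrow> 'k) \<Rightarrow> 'k \<Rightarrow> bool" where
  "has_value m f x y \<longleftrightarrow>
     (\<exists>a b. is_quotient m f a b \<and> eval_poly x b \<noteq> 0 \<and> y = eval_poly x a / eval_poly x b)"

definition rational_map :: "nat \<Rightarrow> nat \<Rightarrow> (nat \<Rightarrow> ('k::field) ratfun) \<Rightarrow> bool" where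
  "rational_map m n \<phi> \<longleftrightarrow> \<phi> \<in> {..<n} \<rightarrow>\<^sub>E (ratfuns m - {0})"

text \<open>
  The image of the domain of definition of \<open>\<phi>\<close> as a map to \<open>T^n\<close>: the points of \<open>T^m\<close> at which
  every component is defined and non-zero.
\<close>

definition rational_image :: "nat \<Rightarrow> nat \<Rightarrow> (nat \<Rightarrow> ('k::field) ratfun) \<Rightarrow> (nat \<Rightarrow> 'k) set" where
  "rational_image m n \<phi> = {y \<in> torus n. \<exists>x\<in>torus m. \<forall>i<n. has_value m (\<phi> i) x (y i)}"

definition dominant_map ::
  "nat \<Rightarrow> nat \<Rightarrow> (nat \<Rightarrow> ('k::field) ratfun) \<Rightarrow> (nat \<Rightarrow> 'k) set \<Rightarrow> bool" where
  "dominant_map m n \<phi> X \<longleftrightarrow>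
     rational_map m n \<phi> \<and> rational_image m n \<phi> \<subseteq> X \<and> X \<subseteq> zariski_closure n (rational_image m n \<phi>)"

text \<open>
  \<open>subst_rat m \<alpha> f\<close> is \<open>f(\<alpha>_0, \<dots>, \<alpha>_(m-1))\<close>.  It is determined as soon as some
  quotient representing \<open>f\<close> has a denominator that stays non-zero after the substitution, which is
  always the case if \<open>\<alpha>\<close> is dominant; otherwise the value is unspecified.
\<close>

definition subst_rat :: "nat \<Rightarrow> (nat \<Rightarrow> ('k::field) ratfun) \<Rightarrow> 'k ratfun \<Rightarrow> 'k ratfun" where
  "subst_rat m \<alpha> f =
     (THE g. \<exists>a b. is_quotient m f a b \<and> subst_poly \<alpha> b \<noteq> 0 \<and> g = subst_poly \<alpha> a / subst_poly \<alpha> b)"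

text \<open>The composite of \<open>\<phi> : T^m \<dashrightarrow> T^n\<close> with \<open>\<alpha> : T^p \<dashrightarrow> T^m\<close>.\<close>

definition rational_comp ::
  "nat \<Rightarrow> nat \<Rightarrow> (nat \<Rightarrow> ('k::field) ratfun) \<Rightarrow> (nat \<Rightarrow> 'k ratfun) \<Rightarrow> (nat \<Rightarrow> 'k ratfun)" where
  "rational_comp m n \<phi> \<alpha> = (\<lambda>i\<in>{..<n}. subst_rat m \<alpha> (\<phi> i))"

text \<open>
  The coefficients at \<open>keys p\<close> are non-zero, so that their valuations are finite.  The value
  for \<open>p = 0\<close> is irrelevant.
\<close>

definition trop_poly :: "('k::field \<Rightarrow> ereal) \<Rightarrow> 'k mpoly \<Rightarrow> (nat \<Rightarrow> real) \<Rightarrow> real" where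
  "trop_poly v p \<xi> =
     Min ((\<lambda>\<alpha>. real_of_ereal (v (Poly_Mapping.lookup p \<alpha>)) +
               (\<Sum>i\<in>Poly_Mapping.keys \<alpha>. \<xi> i * real (Poly_Mapping.lookup \<alpha> i)))
          ` Poly_Mapping.keys p)"

text \<open>
  Independence of the quotient representing \<open>f\<close> is the Gauss lemma: for a valuation \<open>v\<close>,
  \<open>trop_poly v\<close> turns products of non-zero polynomials into sums.
\<close>

definition trop_rat ::
  "('k::field \<Rightarrow> ereal) \<Rightarrow> nat \<Rightarrow> 'k ratfun \<Rightarrow> (nat \<Rightarrow> real) \<Rightarrow> real" where
  "trop_rat v m f \<xi> =
     (THE t. \<exists>a b. is_quotient m f a b \<and> a \<noteq> 0 \<and> t = trop_poly v a \<xi> - trop_poly v b \<xi>)"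

definition trop_map ::
  "('k::field \<Rightarrow> ereal) \<Rightarrow> nat \<Rightarrow> nat \<Rightarrow> (nat \<Rightarrow> 'k ratfun) \<Rightarrow> (nat \<Rightarrow> real) \<Rightarrow> (nat \<Rightarrow> real)" where
  "trop_map v m n \<phi> \<xi> = (\<lambda>i\<in>{..<n}. trop_rat v m (\<phi> i) \<xi>)"

definition im_trop ::
  "('k::field \<Rightarrow> ereal) \<Rightarrow> nat \<Rightarrow> nat \<Rightarrow> (nat \<Rightarrow> 'k ratfun) \<Rightarrow> (nat \<Rightarrow> real) set" where
  "im_trop v m n \<phi> = trop_map v m n \<phi> ` ({..<m} \<rightarrow>\<^sub>E UNIV)"

end

theory Submission
  imports Defs
begin

text \<open>
  Take \<open>\<alpha> = (\<alpha>1 + t \<alpha>2) / (1 + t)\<close> for a fresh variable \<open>t\<close>; the variables of \<open>\<alpha>1\<close> and \<open>\<alpha>2\<close>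
  may even be shared.  A point \<open>\<xi>\<close> of tropical space defines a valuation on the rational functions
  (Gauss's lemma).  As the \<open>t\<close>-coordinate of \<open>\<xi>\<close> tends to \<open>\<infinity>\<close>, the valuation of
  \<open>\<alpha> - \<alpha>1 = t / (1 + t) (\<alpha>2 - \<alpha>1)\<close> tends to \<open>\<infinity>\<close>, hence so does that of \<open>f(\<alpha>) - f(\<alpha>1)\<close> for every
  polynomial \<open>f\<close>.  The valuation of \<open>f(\<alpha>1)\<close> does not depend on the \<open>t\<close>-coordinate and is finite for
  \<open>f \<noteq> 0\<close>, because \<open>\<alpha>1\<close> is dominant; so \<open>f(\<alpha>)\<close> is non-zero and has the same valuation once the
  \<open>t\<close>-coordinate is large.  For \<open>t\<close>-coordinates tending to \<open>-\<infinity>\<close> the same happens with \<open>\<alpha>2\<close>.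
\<close>

subsection \<open>Evaluation of polynomials\<close>

lemma poly_mapping_eq_sum_single:
  "p = (\<Sum>\<alpha>\<in>Poly_Mapping.keys p. Poly_Mapping.single \<alpha> (Poly_Mapping.lookup p \<alpha>))"
  by (rule poly_mapping_eqI) (simp add: lookup_sum lookup_single when_def in_keys_iff)

text \<open>By distributivity. It reduces statements about products to products of single terms,
  both for evaluations and for coefficients.\<close>

lemma poly_mapping_mult_eq_sum_single:
  fixes p q :: "'a::monoid_add \<Rightarrow>\<^sub>0 'b::semiring_0"
  shows "p * q = (\<Sum>(\<alpha>, \<beta>)\<in>Poly_Mapping.keys p \<times> Poly_Mapping.keys q.
     Poly_Mapping.single (\<alpha> + \<beta>) (Poly_Mapping.lookup p \<alpha> * Poly_Mapping.lookup q \<beta>))"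
proof -
  have "p * q = (\<Sum>\<alpha>\<in>Poly_Mapping.keys p. Poly_Mapping.single \<alpha> (Poly_Mapping.lookup p \<alpha>)) *
      (\<Sum>\<beta>\<in>Poly_Mapping.keys q. Poly_Mapping.single \<beta> (Poly_Mapping.lookup q \<beta>))"
    using poly_mapping_eq_sum_single[of p] poly_mapping_eq_sum_single[of q] by argo
  then show ?thesis
    by (simp add: sum_product sum.cartesian_product mult_single)
qed

definition monom_val :: "(nat \<Rightarrow> 'r::comm_semiring_1) \<Rightarrow> (nat \<Rightarrow>\<^sub>0 nat) \<Rightarrow> 'r" where
  "monom_val x \<alpha> = (\<Prod>i\<in>Poly_Mapping.keys \<alpha>. x i ^ Poly_Mapping.lookup \<alpha> i)"

text \<open>The additional factors are \<open>x i ^ 0 = 1\<close>. Monomials with different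
  exponents can thus be compared over a common index set.\<close>

lemma monom_val_superset:
  assumes "finite S" "Poly_Mapping.keys \<alpha> \<subseteq> S"
  shows "monom_val x \<alpha> = (\<Prod>i\<in>S. x i ^ Poly_Mapping.lookup \<alpha> i)"
  unfolding monom_val_def
  using assms by (intro prod.mono_neutral_left) (auto simp: in_keys_iff)

lemma monom_val_add: "monom_val x (\<alpha> + \<beta>) = monom_val x \<alpha> * monom_val x \<beta>"
proof -
  let ?S = "Poly_Mapping.keys \<alpha> \<union> Poly_Mapping.keys \<beta>"
  have "monom_val x (\<alpha> + \<beta>) = (\<Prod>i\<in>?S. x i ^ Poly_Mapping.lookup (\<alpha> + \<beta>) i)"
    by (rule monom_val_superset) (use keys_add[of \<alpha> \<beta>] in auto)
  also have "\<dots> = (\<Prod>i\<in>?S. x i ^ Poly_Mapping.lookup \<alpha> i) * (\<Prod>i\<in>?S. x i ^ Poly_Mapping.lookup \<beta> i)"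
    by (simp add: lookup_add power_add prod.distrib)
  also have "\<dots> = monom_val x \<alpha> * monom_val x \<beta>"
    by (subst (1 2) monom_val_superset[where S = ?S]) auto
  finally show ?thesis .
qed

lemma monom_val_0 [simp]: "monom_val x 0 = 1"
  by (simp add: monom_val_def)

lemma eval_with_eq:
  "eval_with h x p = (\<Sum>\<alpha>\<in>Poly_Mapping.keys p. h (Poly_Mapping.lookup p \<alpha>) * monom_val x \<alpha>)"
  by (simp add: eval_with_def monom_val_def)

text \<open>Instantiated twice: with the identity for evaluation at a point, and with
  \<open>const_rat\<close> for substitution of rational functions. Both are thereby ring
  homomorphisms.\<close>

locale coeff_hom =
  fixes h :: "'k::field \<Rightarrow> 'r::comm_semiring_1"
  assumes hom_0: "h 0 = 0"
    and hom_1: "h 1 = 1"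
    and hom_add: "h (a + b) = h a + h b"
    and hom_mult: "h (a * b) = h a * h b"
begin

lemma eval_with_superset:
  assumes "finite S" "Poly_Mapping.keys p \<subseteq> S"
  shows "eval_with h x p = (\<Sum>\<alpha>\<in>S. h (Poly_Mapping.lookup p \<alpha>) * monom_val x \<alpha>)"
  unfolding eval_with_eq
  using assms by (intro sum.mono_neutral_left) (auto simp: in_keys_iff hom_0)

lemma eval_with_add: "eval_with h x (p + q) = eval_with h x p + eval_with h x q"
proof -
  let ?S = "Poly_Mapping.keys p \<union> Poly_Mapping.keys q"
  have "eval_with h x (p + q) = (\<Sum>\<alpha>\<in>?S. h (Poly_Mapping.lookup (p + q) \<alpha>) * monom_val x \<alpha>)"
    by (rule eval_with_superset) (use keys_add[of p q] in auto)
  also have "\<dots> = (\<Sum>\<alpha>\<in>?S. h (Poly_Mapping.lookup p \<alpha>) * monom_val x \<alpha>) +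
      (\<Sum>\<alpha>\<in>?S. h (Poly_Mapping.lookup q \<alpha>) * monom_val x \<alpha>)"
    by (simp add: lookup_add hom_add algebra_simps sum.distrib)
  also have "\<dots> = eval_with h x p + eval_with h x q"
    by (subst (1 2) eval_with_superset[where S = ?S]) auto
  finally show ?thesis .
qed

lemma eval_with_0 [simp]: "eval_with h x 0 = 0"
  by (simp add: eval_with_def)

lemma eval_with_single [simp]: "eval_with h x (Poly_Mapping.single \<alpha> c) = h c * monom_val x \<alpha>"
  by (cases "c = 0") (simp_all add: eval_with_eq hom_0)

lemma eval_with_1 [simp]: "eval_with h x 1 = 1"
  using eval_with_single[of x 0 1] by (simp add: hom_1)

lemma eval_with_sum: "eval_with h x (\<Sum>i\<in>A. f i) = (\<Sum>i\<in>A. eval_with h x (f i))"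
  by (induction A rule: infinite_finite_induct) (simp_all add: eval_with_add)

lemma eval_with_mult: "eval_with h x (p * q) = eval_with h x p * eval_with h x q"
proof -
  have "eval_with h x (p * q) = (\<Sum>(\<alpha>, \<beta>)\<in>Poly_Mapping.keys p \<times> Poly_Mapping.keys q.
     h (Poly_Mapping.lookup p \<alpha> * Poly_Mapping.lookup q \<beta>) * monom_val x (\<alpha> + \<beta>))"
    by (subst poly_mapping_mult_eq_sum_single) (simp add: eval_with_sum case_prod_unfold)
  also have "\<dots> = eval_with h x p * eval_with h x q"
    unfolding eval_with_eq sum_product sum.cartesian_product
    by (simp add: hom_mult monom_val_add mult_ac)
  finally show ?thesis .
qed

end

interpretation eval_poly: coeff_hom "\<lambda>c::'k::field. c"
  by unfold_locales auto

interpretation subst_poly: coeff_hom "const_rat :: 'k::field \<Rightarrow> 'k ratfun"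
proof
  show "const_rat (a + b) = const_rat a + const_rat b" for a b :: 'k
    by (simp add: const_rat_def single_add)
  show "const_rat (a * b) = const_rat a * const_rat b" for a b :: 'k
    by (simp add: const_rat_def mult_single)
qed (simp_all only: const_rat_def Zero_fract_def One_fract_def single_zero single_one)

lemma eval_with_cong:
  assumes "p \<in> polys m" and "\<And>i. i < m \<Longrightarrow> x i = y i"
  shows "eval_with h x p = eval_with h y p"
proof -
  have "x i = y i" if "\<alpha> \<in> Poly_Mapping.keys p" "i \<in> Poly_Mapping.keys \<alpha>" for \<alpha> i
    using that assms by (auto simp: polys_def)
  then show ?thesis
    unfolding eval_with_def by (intro sum.cong prod.cong arg_cong2[where f = "(*)"] refl) auto
qed

subsection \<open>Polynomials and rational functions in finitely many variables\<close>

lemma polys_add: "p \<in> polys m \<Longrightarrow> q \<in> polys m \<Longrightarrow> p + q \<in> polys m"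
  using keys_add[of p q] unfolding polys_def by blast

lemma polys_mult: "p \<in> polys m \<Longrightarrow> q \<in> polys m \<Longrightarrow> p * q \<in> polys m"
proof -
  assume "p \<in> polys m" "q \<in> polys m"
  then have "Poly_Mapping.keys (\<alpha> + \<beta>) \<subseteq> {..<m}"
    if "\<alpha> \<in> Poly_Mapping.keys p" "\<beta> \<in> Poly_Mapping.keys q" for \<alpha> \<beta>
    using keys_add[of \<alpha> \<beta>] that unfolding polys_def by blast
  then show ?thesis
    using keys_mult[of p q] unfolding polys_def by blast
qed

lemma polys_single: "Poly_Mapping.keys \<alpha> \<subseteq> {..<m} \<Longrightarrow> Poly_Mapping.single \<alpha> c \<in> polys m"
  by (auto simp: polys_def)

lemma polys_0 [simp]: "0 \<in> polys m"
  by (simp add: polys_def)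

lemma polys_1 [simp]: "1 \<in> polys m"
  using polys_single[of 0 m 1] by simp

lemma polys_mono: "m \<le> k \<Longrightarrow> p \<in> polys m \<Longrightarrow> p \<in> polys k"
  unfolding polys_def mem_Collect_eq by (meson lessThan_subset_iff subset_trans)

lemma polys_uminus: "p \<in> polys m \<Longrightarrow> - p \<in> polys m"
  by (simp add: polys_def)

lemma ratfunsI: "a \<in> polys m \<Longrightarrow> b \<in> polys m \<Longrightarrow> b \<noteq> 0 \<Longrightarrow> Fract a b \<in> ratfuns m"
  by (auto simp: ratfuns_def is_quotient_def)

lemma ratfunsE:
  assumes "f \<in> ratfuns m"
  obtains a b where "f = Fract a b" "a \<in> polys m" "b \<in> polys m" "b \<noteq> 0"
  using assms by (auto simp: ratfuns_def is_quotient_def)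

lemma ratfuns_nonzeroE:
  assumes "f \<in> ratfuns m" "f \<noteq> 0"
  obtains a b where "f = Fract a b" "a \<in> polys m" "b \<in> polys m" "b \<noteq> 0" "a \<noteq> 0"
proof -
  obtain a b where ab: "f = Fract a b" "a \<in> polys m" "b \<in> polys m" "b \<noteq> 0"
    using assms(1) by (rule ratfunsE)
  moreover have "a \<noteq> 0"
    using ab(1) assms(2) by (auto simp: fract_collapse)
  ultimately show ?thesis
    by (rule that)
qed

lemma ratfuns_mono: "m \<le> k \<Longrightarrow> f \<in> ratfuns m \<Longrightarrow> f \<in> ratfuns k"
  by (erule ratfunsE) (simp add: ratfunsI polys_mono[of m k])

lemma ratfuns_add:
  assumes "f \<in> ratfuns m" "g \<in> ratfuns m"
  shows "f + g \<in> ratfuns m"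
proof -
  obtain a b where f: "f = Fract a b" "a \<in> polys m" "b \<in> polys m" "b \<noteq> 0"
    using assms(1) by (rule ratfunsE)
  obtain c d where g: "g = Fract c d" "c \<in> polys m" "d \<in> polys m" "d \<noteq> 0"
    using assms(2) by (rule ratfunsE)
  show ?thesis
    unfolding f(1) g(1) add_fract[OF f(4) g(4)]
    using f g by (intro ratfunsI polys_add polys_mult) simp_all
qed

lemma ratfuns_uminus: "f \<in> ratfuns m \<Longrightarrow> - f \<in> ratfuns m"
  by (erule ratfunsE) (simp add: ratfunsI polys_uminus)

lemma ratfuns_diff: "f \<in> ratfuns m \<Longrightarrow> g \<in> ratfuns m \<Longrightarrow> f - g \<in> ratfuns m"
  using ratfuns_add[of f m "- g"] ratfuns_uminus[of g m] by simp

lemma ratfuns_mult: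
  assumes "f \<in> ratfuns m" "g \<in> ratfuns m"
  shows "f * g \<in> ratfuns m"
proof -
  obtain a b where f: "f = Fract a b" "a \<in> polys m" "b \<in> polys m" "b \<noteq> 0"
    using assms(1) by (rule ratfunsE)
  obtain c d where g: "g = Fract c d" "c \<in> polys m" "d \<in> polys m" "d \<noteq> 0"
    using assms(2) by (rule ratfunsE)
  show ?thesis
    unfolding f(1) g(1) mult_fract
    using f g by (intro ratfunsI polys_mult) simp_all
qed

lemma ratfuns_0 [simp]: "0 \<in> ratfuns m"
  unfolding Zero_fract_def by (rule ratfunsI) simp_all

lemma ratfuns_1 [simp]: "1 \<in> ratfuns m"
  unfolding One_fract_def by (rule ratfunsI) simp_all

lemma ratfuns_const [simp]: "const_rat c \<in> ratfuns m"
  unfolding const_rat_def by (rule ratfunsI) (simp_all add: polys_single)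

lemma ratfuns_divide:
  assumes "f \<in> ratfuns m" "g \<in> ratfuns m"
  shows "f / g \<in> ratfuns m"
\<comment> \<open>For \<open>g = 0\<close> the quotient is \<open>0\<close> by convention, which is
  a rational function as well.\<close>
proof (cases "g = 0")
  case False
  obtain a b where f: "f = Fract a b" "a \<in> polys m" "b \<in> polys m" "b \<noteq> 0"
    using assms(1) by (rule ratfunsE)
  obtain c d where g: "g = Fract c d" "c \<in> polys m" "d \<in> polys m" "d \<noteq> 0"
    using assms(2) by (rule ratfunsE)
  have "c \<noteq> 0"
    using False g by (auto simp: fract_collapse)
  then show ?thesis
    unfolding f(1) g(1) divide_fract using f g by (intro ratfunsI polys_mult) simp_all
qed simp

lemma ratfuns_power: "f \<in> ratfuns m \<Longrightarrow> f ^ k \<in> ratfuns m"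
  by (induction k) (auto intro: ratfuns_mult)

lemma ratfuns_subst_poly:
  assumes "a \<in> polys m" and "\<And>i. i < m \<Longrightarrow> \<alpha> i \<in> ratfuns k"
  shows "subst_poly \<alpha> a \<in> ratfuns k"
proof -
  have sum: "(\<Sum>i\<in>A. f i) \<in> ratfuns k" if "\<And>i. i \<in> A \<Longrightarrow> f i \<in> ratfuns k"
    for f :: "(nat \<Rightarrow>\<^sub>0 nat) \<Rightarrow> 'a ratfun" and A
    using that by (induction A rule: infinite_finite_induct) (auto intro: ratfuns_add)
  have prod: "(\<Prod>i\<in>A. f i) \<in> ratfuns k" if "\<And>i. i \<in> A \<Longrightarrow> f i \<in> ratfuns k"
    for f :: "nat \<Rightarrow> 'a ratfun" and A
    using that by (induction A rule: infinite_finite_induct) (auto intro: ratfuns_mult)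
  show ?thesis
    unfolding eval_with_def using assms
    by (intro sum prod ratfuns_mult ratfuns_power ratfuns_const) (auto simp: polys_def)
qed

subsection \<open>Points outside a hypersurface\<close>

text \<open>In a finite field, 1 plus the product of all linear factors X - a takes only the value
  1, so this polynomial of positive degree has no root.\<close>

lemma infinite_UNIV_alg_closed_field: "infinite (UNIV :: 'k::alg_closed_field set)"
proof
  assume fin: "finite (UNIV :: 'k set)"
  define p :: "'k poly" where "p = (\<Prod>a\<in>UNIV. [:- a, 1:]) + 1"
  have "degree (\<Prod>a\<in>UNIV. [:- a, 1:] :: 'k poly) = card (UNIV :: 'k set)"
    by (subst degree_prod_eq_sum_degree) simp_all
  moreover have "card (UNIV :: 'k set) > 0"
    using fin by (simp add: card_gt_0_iff)
  ultimately have "degree p > 0"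
    unfolding p_def by (subst degree_add_eq_left) simp_all
  then obtain x where "poly p x = 0"
    using alg_closed_imp_poly_has_root by blast
  moreover have "(\<Prod>a\<in>UNIV. x - a) = 0"
    using fin by (auto simp: prod_zero_iff)
  ultimately show False
    by (simp add: p_def poly_prod)
qed

text \<open>The exponent \<open>\<alpha>\<close> read in base \<open>B\<close>, with digits of any
  size: if \<open>s ^ (B ^ i)\<close> replaces the \<open>i\<close>-th variable, the monomial with
  exponent \<open>\<alpha>\<close> becomes \<open>s ^ weight B \<alpha>\<close>.\<close>

definition weight :: "nat \<Rightarrow> (nat \<Rightarrow>\<^sub>0 nat) \<Rightarrow> nat" where
  "weight B \<alpha> = (\<Sum>i\<in>Poly_Mapping.keys \<alpha>. B ^ i * Poly_Mapping.lookup \<alpha> i)"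

text \<open>Kronecker's substitution: all but finitely many bases \<open>B\<close> separate two given exponents,
  since \<open>B\<close> would be a root of the difference of the corresponding integer polynomials.\<close>

lemma weight_inj_on:
  assumes "finite A"
  obtains B where "inj_on (weight B) A"
proof -
  define P :: "(nat \<Rightarrow>\<^sub>0 nat) \<Rightarrow> int poly" where
    "P \<alpha> = (\<Sum>i\<in>Poly_Mapping.keys \<alpha>. monom (int (Poly_Mapping.lookup \<alpha> i)) i)" for \<alpha>
  have coeff: "coeff (P \<alpha>) i = int (Poly_Mapping.lookup \<alpha> i)" for \<alpha> i
    by (auto simp: P_def coeff_sum in_keys_iff)
  have P_inj: "P \<alpha> \<noteq> P \<beta>" if "\<alpha> \<noteq> \<beta>" for \<alpha> \<beta>
    using that coeff by (metis of_nat_eq_iff poly_mapping_eqI)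
  have eval: "poly (P \<alpha>) (int B) = int (weight B \<alpha>)" for \<alpha> B
    by (simp add: P_def weight_def poly_sum poly_monom mult_ac)
  define R where "R = (\<Union>(\<alpha>, \<beta>)\<in>{(\<alpha>, \<beta>). \<alpha> \<in> A \<and> \<beta> \<in> A \<and> \<alpha> \<noteq> \<beta>}. {x. poly (P \<alpha> - P \<beta>) x = 0})"
  have "finite {(\<alpha>, \<beta>). \<alpha> \<in> A \<and> \<beta> \<in> A \<and> \<alpha> \<noteq> \<beta>}"
    by (rule finite_subset[of _ "A \<times> A"]) (use assms in auto)
  moreover have "finite {x. poly (P \<alpha> - P \<beta>) x = 0}" if "\<alpha> \<noteq> \<beta>" for \<alpha> \<beta>
    using P_inj[OF that] by (intro poly_roots_finite) simp
  ultimately have "finite R"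
    unfolding R_def by (intro finite_UN_I) auto
  then have "finite (int -` R)"
    by (intro finite_vimageI) auto
  then obtain B where B: "int B \<notin> R"
    using ex_new_if_finite[OF infinite_UNIV_nat] by blast
  have "inj_on (weight B) A"
  proof (rule inj_onI, rule ccontr)
    fix \<alpha> \<beta> assume "\<alpha> \<in> A" "\<beta> \<in> A" "weight B \<alpha> = weight B \<beta>" "\<alpha> \<noteq> \<beta>"
    then have "int B \<in> R"
      unfolding R_def by (intro UN_I[of "(\<alpha>, \<beta>)"]) (auto simp: eval)
    with B show False by contradiction
  qed
  with that show ?thesis .
qed

text \<open>Kronecker's substitution turns \<open>p\<close> into a non-zero univariate polynomial
  \<open>P\<close>. It has finitely many roots, so the infinite field contains a non-root
  \<open>s\<close>; avoiding \<open>0\<close> too keeps the point in the torus.\<close>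

lemma ex_eval_poly_nonzero:
  fixes p :: "'k::alg_closed_field mpoly"
  assumes "p \<noteq> 0"
  obtains x where "\<And>i. x i \<noteq> 0" "eval_poly x p \<noteq> 0"
proof -
  let ?K = "Poly_Mapping.keys p"
  obtain B where B: "inj_on (weight B) ?K"
    using weight_inj_on[of ?K] by auto
  define P where "P = (\<Sum>\<alpha>\<in>?K. monom (Poly_Mapping.lookup p \<alpha>) (weight B \<alpha>))"
  have "?K \<noteq> {}"
    using assms by simp
  then obtain \<alpha> where \<alpha>: "\<alpha> \<in> ?K"
    by blast
  \<comment> \<open>No cancellation occurs: distinct exponents of \<open>p\<close> have distinct
    weights, so only \<open>\<alpha>\<close> contributes to this coefficient.\<close>
  have "coeff P (weight B \<alpha>) = (\<Sum>\<beta>\<in>?K. if \<beta> = \<alpha> then Poly_Mapping.lookup p \<beta> else 0)"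
    unfolding P_def coeff_sum using B \<alpha> by (intro sum.cong) (auto dest: inj_onD)
  also have "\<dots> = Poly_Mapping.lookup p \<alpha>"
    using \<alpha> by simp
  finally have "P \<noteq> 0"
    using \<alpha> by (auto simp: in_keys_iff)
  then have "finite ({s. poly P s = 0} \<union> {0})"
    by (simp add: poly_roots_finite)
  then obtain s where s: "poly P s \<noteq> 0" "s \<noteq> 0"
    using ex_new_if_finite[OF infinite_UNIV_alg_closed_field] by blast
  define x where "x i = s ^ (B ^ i)" for i
  have "monom_val x \<alpha> = s ^ weight B \<alpha>" for \<alpha>
    by (simp add: monom_val_def weight_def x_def power_sum power_mult)
  then have "eval_poly x p = poly P s"
    by (simp add: eval_with_eq P_def poly_sum poly_monom)
  with s that[of x] show ?thesis
    by (simp add: x_def)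
qed

subsection \<open>Dominance\<close>

text \<open>\<^const>\<open>has_value\<close> without the restriction to finitely many variables.\<close>

definition takes_value :: "(nat \<Rightarrow> 'k::field) \<Rightarrow> 'k ratfun \<Rightarrow> 'k \<Rightarrow> bool" where
  "takes_value x f y \<longleftrightarrow>
     (\<exists>a b. f = Fract a b \<and> eval_poly x b \<noteq> 0 \<and> y = eval_poly x a / eval_poly x b)"

lemma takes_valueE:
  assumes "takes_value x f y"
  obtains a b where "f = Fract a b" "b \<noteq> 0" "eval_poly x b \<noteq> 0" "y = eval_poly x a / eval_poly x b"
  using assms unfolding takes_value_def by (metis eval_poly.eval_with_0)

lemma has_value_imp_takes_value: "has_value m f x y \<Longrightarrow> takes_value x f y"
  unfolding has_value_def is_quotient_def takes_value_def by blast

lemma takes_value_Fract: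
  "eval_poly x b \<noteq> 0 \<Longrightarrow> takes_value x (Fract a b) (eval_poly x a / eval_poly x b)"
  unfolding takes_value_def by blast

lemma takes_value_add:
  assumes "takes_value x f y" "takes_value x g z"
  shows "takes_value x (f + g) (y + z)"
proof -
  obtain a b where f: "f = Fract a b" "b \<noteq> 0" "eval_poly x b \<noteq> 0" "y = eval_poly x a / eval_poly x b"
    using assms(1) by (rule takes_valueE)
  obtain c d where g: "g = Fract c d" "d \<noteq> 0" "eval_poly x d \<noteq> 0" "z = eval_poly x c / eval_poly x d"
    using assms(2) by (rule takes_valueE)
  have "y + z = eval_poly x (a * d + c * b) / eval_poly x (b * d)"
    using f(3) g(3) unfolding f(4) g(4)
    by (simp add: eval_poly.eval_with_add eval_poly.eval_with_mult add_frac_eq)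
  moreover have "f + g = Fract (a * d + c * b) (b * d)"
    using f g by simp
  ultimately show ?thesis
    unfolding takes_value_def using f g by (metis eval_poly.eval_with_mult mult_eq_0_iff)
qed

lemma takes_value_mult:
  assumes "takes_value x f y" "takes_value x g z"
  shows "takes_value x (f * g) (y * z)"
proof -
  obtain a b where f: "f = Fract a b" "b \<noteq> 0" "eval_poly x b \<noteq> 0" "y = eval_poly x a / eval_poly x b"
    using assms(1) by (rule takes_valueE)
  obtain c d where g: "g = Fract c d" "d \<noteq> 0" "eval_poly x d \<noteq> 0" "z = eval_poly x c / eval_poly x d"
    using assms(2) by (rule takes_valueE)
  have "y * z = eval_poly x (a * c) / eval_poly x (b * d)"
    using f g by (simp add: eval_poly.eval_with_mult)
  moreover have "f * g = Fract (a * c) (b * d)"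
    using f g by simp
  ultimately show ?thesis
    unfolding takes_value_def using f g by (metis eval_poly.eval_with_mult mult_eq_0_iff)
qed

lemma takes_value_const: "takes_value x (const_rat c) c"
  using takes_value_Fract[of x 1 "Poly_Mapping.single 0 c"] by (simp add: const_rat_def)

lemma takes_value_power: "takes_value x f y \<Longrightarrow> takes_value x (f ^ k) (y ^ k)"
proof (induction k)
  case 0
  then show ?case using takes_value_const[of x 1] by (simp add: subst_poly.hom_1)
qed (simp add: takes_value_mult)

text \<open>Evaluation respects sums and products wherever the denominators do not vanish. This
  relates zeros of \<open>p\<close> on the image of \<open>\<alpha>\<close> to zeros of the
  composite.\<close>

lemma takes_value_subst_poly:
  assumes "p \<in> polys m" and "\<And>i. i < m \<Longrightarrow> takes_value x (\<alpha> i) (y i)"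
  shows "takes_value x (subst_poly \<alpha> p) (eval_poly y p)"
proof -
  have sum: "takes_value x (\<Sum>i\<in>A. f i) (\<Sum>i\<in>A. g i)" if "\<And>i. i \<in> A \<Longrightarrow> takes_value x (f i) (g i)"
    for f g and A :: "(nat \<Rightarrow>\<^sub>0 nat) set"
    using that takes_value_const[of x 0]
    by (induction A rule: infinite_finite_induct) (auto intro: takes_value_add simp: subst_poly.hom_0)
  have prod: "takes_value x (\<Prod>i\<in>A. f i) (\<Prod>i\<in>A. g i)" if "\<And>i. i \<in> A \<Longrightarrow> takes_value x (f i) (g i)"
    for f g and A :: "nat set"
    using that takes_value_const[of x 1]
    by (induction A rule: infinite_finite_induct) (auto intro: takes_value_mult simp: subst_poly.hom_1)
  show ?thesis
    unfolding eval_with_def using assms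
    by (intro sum prod takes_value_mult takes_value_power takes_value_const) (auto simp: polys_def)
qed

text \<open>The value may come from another quotient \<open>Fract c d\<close>. Cross-multiplication
  moves the zero to the numerator \<open>a\<close>, even if \<open>b\<close> vanishes at
  \<open>x\<close>.\<close>

lemma takes_value_0_iff:
  assumes "takes_value x (Fract a b) 0" "b \<noteq> 0"
  shows "eval_poly x a = 0"
proof -
  obtain c d where cd: "Fract a b = Fract c d" "d \<noteq> 0" "eval_poly x d \<noteq> 0" "0 = eval_poly x c / eval_poly x d"
    using assms(1) by (rule takes_valueE)
  then have "a * d = c * b"
    using assms(2) by (simp add: eq_fract)
  then have "eval_poly x a * eval_poly x d = eval_poly x c * eval_poly x b"
    by (metis eval_poly.eval_with_mult)
  with cd show ?thesis by simp
qed

lemma takes_value_0_unique: "takes_value x 0 y \<Longrightarrow> y = 0"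
proof (erule takes_valueE)
  fix a b assume "0 = Fract a b" "b \<noteq> 0" "y = eval_poly x a / eval_poly x b"
  then show "y = 0"
    by (auto simp: Zero_fract_def eq_fract)
qed

text \<open>If the composite were \<open>0\<close>, then \<open>a\<close> would vanish on the image
  of \<open>\<alpha>\<close>, hence by density on the whole torus, although a non-zero polynomial
  has a non-zero there.\<close>

lemma dominant_imp_subst_poly_nonzero:
  fixes \<alpha> :: "nat \<Rightarrow> 'k::alg_closed_field ratfun"
  assumes dom: "dominant_map p m \<alpha> (torus m)" and a: "a \<in> polys m" "a \<noteq> 0"
  shows "subst_poly \<alpha> a \<noteq> 0"
proof
  assume zero: "subst_poly \<alpha> a = 0"
  obtain x where x: "\<And>i. x i \<noteq> 0" "eval_poly x a \<noteq> 0"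
    using ex_eval_poly_nonzero[OF a(2)] by blast
  define x' where "x' = restrict x {..<m}"
  have "eval_poly x' a = eval_poly x a"
    by (rule eval_with_cong[OF a(1)]) (simp add: x'_def)
  moreover have "x' \<in> torus m"
    using x by (auto simp: x'_def torus_def)
  moreover have "eval_poly y a = 0" if y: "y \<in> rational_image p m \<alpha>" for y
  proof -
    obtain z where "\<forall>i<m. has_value p (\<alpha> i) z (y i)"
      using y unfolding rational_image_def by blast
    then have "takes_value z (subst_poly \<alpha> a) (eval_poly y a)"
      by (intro takes_value_subst_poly[OF a(1)] has_value_imp_takes_value[of p]) auto
    then show ?thesis
      unfolding zero by (rule takes_value_0_unique)
  qed
  moreover have "torus m \<subseteq> zariski_closure m (rational_image p m \<alpha>)"
    using dom by (simp add: dominant_map_def)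
  ultimately show False
    using x(2) a(1) by (auto simp: zariski_closure_def)
qed

text \<open>Density means that only \<open>0\<close> vanishes on the image. For
  \<open>a \<noteq> 0\<close> the composite is non-zero, so a general point of the source is mapped
  to a point where \<open>a\<close> does not vanish.\<close>

lemma dominant_mapI:
  fixes \<alpha> :: "nat \<Rightarrow> 'k::alg_closed_field ratfun"
  assumes rat: "rational_map p m \<alpha>"
    and nz: "\<And>a. a \<in> polys m \<Longrightarrow> a \<noteq> 0 \<Longrightarrow> subst_poly \<alpha> a \<noteq> 0"
  shows "dominant_map p m \<alpha> (torus m)"
proof -
  have "a = 0" if a: "a \<in> polys m" and vanish: "\<And>y. y \<in> rational_image p m \<alpha> \<Longrightarrow> eval_poly y a = 0" for a
  proof (rule ccontr)
    assume "a \<noteq> 0"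
    then have s: "subst_poly \<alpha> a \<noteq> 0"
      using nz a by blast
    \<comment> \<open>This quotient may involve any variables. The point \<open>x\<close> below
      therefore has coordinates at every index, and is cut down to \<open>x'\<close> only to exhibit
      a point of the image.\<close>
    obtain F G where FG: "subst_poly \<alpha> a = Fract F G" "G \<noteq> 0"
      by (rule Fract_cases)
    then have "F \<noteq> 0"
      using s by (auto simp: fract_collapse)
    have "\<exists>b c. \<alpha> i = Fract b c \<and> b \<in> polys p \<and> c \<in> polys p \<and> b \<noteq> 0 \<and> c \<noteq> 0" if "i < m" for i
    proof -
      have "\<alpha> i \<in> ratfuns p" "\<alpha> i \<noteq> 0"
        using rat that by (auto simp: rational_map_def)
      then show ?thesis
        by (elim ratfunsE) (metis fract_collapse(1))
    qed
    then obtain b c where bc: "\<And>i. i < m \<Longrightarrow> \<alpha> i = Fract (b i) (c i)"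
        "\<And>i. i < m \<Longrightarrow> b i \<in> polys p" "\<And>i. i < m \<Longrightarrow> c i \<in> polys p"
        "\<And>i. i < m \<Longrightarrow> b i \<noteq> 0" "\<And>i. i < m \<Longrightarrow> c i \<noteq> 0"
      by metis
    \<comment> \<open>A single polynomial encodes all conditions on \<open>x\<close>: each
      \<open>\<alpha> i\<close> is defined and non-zero there, and \<open>F\<close> does not vanish.
      Nothing is asked of \<open>G\<close>, by \<open>takes_value_0_iff\<close>.\<close>
    have "F * (\<Prod>i<m. b i * c i) \<noteq> 0"
      using \<open>F \<noteq> 0\<close> bc by simp
    then obtain x where x: "\<And>i. x i \<noteq> 0" "eval_poly x (F * (\<Prod>i<m. b i * c i)) \<noteq> 0"
      by (rule ex_eval_poly_nonzero) blast
    have "eval_poly x (b i) \<noteq> 0 \<and> eval_poly x (c i) \<noteq> 0" if "i < m" for i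
    proof -
      have "F * (\<Prod>i<m. b i * c i) = b i * (c i * (F * (\<Prod>i\<in>{..<m} - {i}. b i * c i)))"
        using that by (simp add: prod.remove[of "{..<m}" i] mult_ac)
      with x(2) show ?thesis
        by (auto simp: eval_poly.eval_with_mult)
    qed
    note nz' = this
    define y where "y = (\<lambda>i\<in>{..<m}. eval_poly x (b i) / eval_poly x (c i))"
    define x' where "x' = restrict x {..<p}"
    have x': "eval_poly x' q = eval_poly x q" if "q \<in> polys p" for q
      by (rule eval_with_cong[OF that]) (simp add: x'_def)
    have "has_value p (\<alpha> i) x' (y i)" if "i < m" for i
      unfolding has_value_def is_quotient_def using bc(1-5)[OF that] nz'[OF that] that
      by (intro exI[of _ "b i"] exI[of _ "c i"]) (simp add: x' y_def)
    moreover have "x' \<in> torus p" "y \<in> torus m"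
      using x(1) nz' by (auto simp: x'_def y_def torus_def)
    ultimately have "y \<in> rational_image p m \<alpha>"
      by (auto simp: rational_image_def)
    then have "eval_poly y a = 0"
      by (rule vanish)
    moreover have "takes_value x (subst_poly \<alpha> a) (eval_poly y a)"
      using bc(1) nz' by (intro takes_value_subst_poly[OF a]) (auto simp: y_def intro!: takes_value_Fract)
    ultimately have "eval_poly x F = 0"
      using takes_value_0_iff FG by metis
    with x(2) show False
      by (simp add: eval_poly.eval_with_mult)
  qed
  then have "torus m \<subseteq> zariski_closure m (rational_image p m \<alpha>)"
    unfolding zariski_closure_def by (smt (verit) eval_poly.eval_with_0 mem_Collect_eq subsetI)
  then show ?thesis
    using rat by (auto simp: dominant_map_def rational_image_def)
qed

subsection \<open>Valuations\<close>

text \<open>Stated for an arbitrary field, since it serves both the given valuation on the constants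
  and the valuations \<open>rat_val v \<xi>\<close> on the rational functions.\<close>

locale valued_field =
  fixes v :: "'k::field \<Rightarrow> ereal"
  assumes valuation: "valuation v"
begin

lemma not_MInfty [simp]: "v x \<noteq> -\<infinity>"
  and eq_PInfty_iff [simp]: "v x = \<infinity> \<longleftrightarrow> x = 0"
  and v_mult: "v (x * y) = v x + v y"
  and v_add: "min (v x) (v y) \<le> v (x + y)"
  using valuation by (auto simp: valuation_def)

lemma v_0 [simp]: "v 0 = \<infinity>"
  by simp

lemma v_finiteE:
  assumes "x \<noteq> 0"
  obtains r where "v x = ereal r"
  by (cases "v x") (use assms not_MInfty[of x] eq_PInfty_iff[of x] that in auto)

lemma v_finite: "x \<noteq> 0 \<Longrightarrow> v x = ereal (real_of_ereal (v x))"
  by (cases "v x") (use not_MInfty[of x] eq_PInfty_iff[of x] in auto)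

lemma v_1 [simp]: "v 1 = 0"
  using v_mult[of 1 1] v_finite[of 1] by (cases "v 1") auto

text \<open>From \<open>(-1) * (-1) = 1\<close>, twice the valuation of \<open>-1\<close> is
  \<open>0\<close>, so it is \<open>0\<close> itself.\<close>

lemma v_uminus [simp]: "v (- x) = v x"
proof -
  have "v (-1) + v (-1) = 0"
    using v_mult[of "-1" "-1"] by simp
  then have "v (-1) = 0"
    by (cases "v (-1)") auto
  then show ?thesis
    using v_mult[of "-1" x] by simp
qed

lemma v_diff: "min (v x) (v y) \<le> v (x - y)"
  using v_add[of x "- y"] by simp

text \<open>Write \<open>x\<close> as \<open>(x + y) - y\<close>: the lower bound for its valuation
  cannot be attained by \<open>y\<close>, so it comes from \<open>x + y\<close>.\<close>

lemma v_add_eq: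
  assumes "v x < v y"
  shows "v (x + y) = v x"
proof (rule antisym)
  show "v x \<le> v (x + y)"
    using v_add[of x y] assms by simp
  show "v (x + y) \<le> v x"
    using v_diff[of "x + y" y] assms by (auto simp: min_le_iff_disj)
qed

lemma v_divide:
  assumes "y \<noteq> 0"
  shows "v (x / y) = v x - v y"
proof -
  have "v x = v (x / y) + v y"
    using assms by (simp flip: v_mult)
  then show ?thesis
    using v_finite[OF assms] by (cases "v (x / y)"; cases "v y"; cases "v x") auto
qed

lemma v_sum_ge: "(\<And>i. i \<in> A \<Longrightarrow> t \<le> v (f i)) \<Longrightarrow> t \<le> v (\<Sum>i\<in>A. f i)"
proof (induction A rule: infinite_finite_induct)
  case (insert i A)
  then have "t \<le> min (v (f i)) (v (\<Sum>i\<in>A. f i))"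
    by simp
  also have "\<dots> \<le> v (f i + (\<Sum>i\<in>A. f i))"
    by (rule v_add)
  finally show ?case using insert by simp
qed auto

text \<open>The bound \<open>t < \<infinity>\<close> takes care of the empty sum, whose valuation is
  \<open>\<infinity>\<close>.\<close>

lemma v_sum_gt: "t < \<infinity> \<Longrightarrow> (\<And>i. i \<in> A \<Longrightarrow> t < v (f i)) \<Longrightarrow> t < v (\<Sum>i\<in>A. f i)"
proof (induction A rule: infinite_finite_induct)
  case (insert i A)
  then have "t < min (v (f i)) (v (\<Sum>i\<in>A. f i))"
    by simp
  also have "\<dots> \<le> v (f i + (\<Sum>i\<in>A. f i))"
    by (rule v_add)
  finally show ?case using insert by simp
qed auto

end

subsection \<open>The tropical valuation on rational functions\<close>

definition pairing :: "(nat \<Rightarrow> real) \<Rightarrow> (nat \<Rightarrow>\<^sub>0 nat) \<Rightarrow> real" where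
  "pairing \<xi> \<alpha> = (\<Sum>i\<in>Poly_Mapping.keys \<alpha>. \<xi> i * real (Poly_Mapping.lookup \<alpha> i))"

lemma pairing_superset:
  assumes "finite S" "Poly_Mapping.keys \<alpha> \<subseteq> S"
  shows "pairing \<xi> \<alpha> = (\<Sum>i\<in>S. \<xi> i * real (Poly_Mapping.lookup \<alpha> i))"
  unfolding pairing_def
  using assms by (intro sum.mono_neutral_left) (auto simp: in_keys_iff)

lemma pairing_add: "pairing \<xi> (\<alpha> + \<beta>) = pairing \<xi> \<alpha> + pairing \<xi> \<beta>"
proof -
  let ?S = "Poly_Mapping.keys \<alpha> \<union> Poly_Mapping.keys \<beta>"
  have "pairing \<xi> (\<alpha> + \<beta>) = (\<Sum>i\<in>?S. \<xi> i * real (Poly_Mapping.lookup (\<alpha> + \<beta>) i))"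
    by (rule pairing_superset) (use keys_add[of \<alpha> \<beta>] in auto)
  also have "\<dots> = (\<Sum>i\<in>?S. \<xi> i * real (Poly_Mapping.lookup \<alpha> i)) + (\<Sum>i\<in>?S. \<xi> i * real (Poly_Mapping.lookup \<beta> i))"
    by (simp add: lookup_add distrib_left sum.distrib)
  also have "\<dots> = pairing \<xi> \<alpha> + pairing \<xi> \<beta>"
    by (subst (1 2) pairing_superset[where S = ?S]) auto
  finally show ?thesis .
qed

lemma pairing_0 [simp]: "pairing \<xi> 0 = 0"
  by (simp add: pairing_def)

lemma pairing_single [simp]: "pairing \<xi> (Poly_Mapping.single i k) = \<xi> i * real k"
  by (cases "k = 0") (simp_all add: pairing_def)

lemma lookup_mult_eq_sum:
  "Poly_Mapping.lookup (p * q) \<gamma> = (\<Sum>(\<alpha>, \<beta>)\<in>Poly_Mapping.keys p \<times> Poly_Mapping.keys q.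
     if \<alpha> + \<beta> = \<gamma> then Poly_Mapping.lookup p \<alpha> * Poly_Mapping.lookup q \<beta> else 0)"
  for p q :: "'a::monoid_add \<Rightarrow>\<^sub>0 'b::semiring_0"
  by (subst poly_mapping_mult_eq_sum_single)
    (auto simp: lookup_sum lookup_single when_def case_prod_unfold intro!: sum.cong)

text \<open>The Gauss (or monomial) valuation with weights \<open>\<xi>\<close>. The value at
  \<open>0\<close>, where \<open>trop_poly\<close> is the minimum of an empty set, is set to
  \<open>\<infinity>\<close> as the valuation axioms require.\<close>

definition poly_val :: "('k::field \<Rightarrow> ereal) \<Rightarrow> (nat \<Rightarrow> real) \<Rightarrow> 'k mpoly \<Rightarrow> ereal" where
  "poly_val v \<xi> p = (if p = 0 then \<infinity> else ereal (trop_poly v p \<xi>))"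

text \<open>Unlike in \<open>trop_rat\<close>, the quotients range over all variables and
  \<open>0\<close> is included, which gives one valuation on the whole fraction field.\<close>

definition rat_val :: "('k::field \<Rightarrow> ereal) \<Rightarrow> (nat \<Rightarrow> real) \<Rightarrow> 'k ratfun \<Rightarrow> ereal" where
  "rat_val v \<xi> f = (THE t. \<exists>a b. b \<noteq> 0 \<and> f = Fract a b \<and> t = poly_val v \<xi> a - poly_val v \<xi> b)"

lemma trop_poly_eq:
  "trop_poly v p \<xi> = Min ((\<lambda>\<alpha>. real_of_ereal (v (Poly_Mapping.lookup p \<alpha>)) + pairing \<xi> \<alpha>) ` Poly_Mapping.keys p)"
  by (simp add: trop_poly_def pairing_def)

lemma poly_val_cong:
  assumes "p \<in> polys m" and "\<And>i. i < m \<Longrightarrow> \<xi> i = \<xi>' i"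
  shows "poly_val v \<xi> p = poly_val v \<xi>' p"
proof -
  have "pairing \<xi> \<alpha> = pairing \<xi>' \<alpha>" if "\<alpha> \<in> Poly_Mapping.keys p" for \<alpha>
    unfolding pairing_def using that assms by (intro sum.cong) (auto simp: polys_def)
  then show ?thesis
    unfolding poly_val_def trop_poly_eq by (simp cong: image_cong)
qed

context valued_field
begin

lemma poly_val_not_MInfty [simp]: "poly_val v \<xi> p \<noteq> -\<infinity>"
  and poly_val_eq_PInfty_iff [simp]: "poly_val v \<xi> p = \<infinity> \<longleftrightarrow> p = 0"
  by (auto simp: poly_val_def)

lemma poly_val_0 [simp]: "poly_val v \<xi> 0 = \<infinity>"
  by simp

text \<open>Outside the support the right-hand side is \<open>\<infinity>\<close>. With
  \<open>ex_poly_val_eq\<close> this describes the minimum over all exponents, without reference to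
  the support.\<close>

lemma poly_val_le: "poly_val v \<xi> p \<le> v (Poly_Mapping.lookup p \<alpha>) + ereal (pairing \<xi> \<alpha>)"
proof (cases "\<alpha> \<in> Poly_Mapping.keys p")
  case True
  then have "trop_poly v p \<xi> \<le> real_of_ereal (v (Poly_Mapping.lookup p \<alpha>)) + pairing \<xi> \<alpha>"
    unfolding trop_poly_eq by (intro Min_le) auto
  moreover obtain r where "v (Poly_Mapping.lookup p \<alpha>) = ereal r"
    using True by (auto simp: in_keys_iff elim: v_finiteE)
  moreover have "p \<noteq> 0"
    using True by auto
  ultimately show ?thesis
    by (simp add: poly_val_def)
qed (simp add: in_keys_iff)

lemma ex_poly_val_eq:
  assumes "p \<noteq> 0"
  shows "\<exists>\<alpha>. poly_val v \<xi> p = v (Poly_Mapping.lookup p \<alpha>) + ereal (pairing \<xi> \<alpha>)"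
proof -
  have "trop_poly v p \<xi> \<in> (\<lambda>\<alpha>. real_of_ereal (v (Poly_Mapping.lookup p \<alpha>)) + pairing \<xi> \<alpha>) ` Poly_Mapping.keys p"
    unfolding trop_poly_eq using assms by (intro Min_in) auto
  then obtain \<alpha> where \<alpha>: "\<alpha> \<in> Poly_Mapping.keys p"
    "trop_poly v p \<xi> = real_of_ereal (v (Poly_Mapping.lookup p \<alpha>)) + pairing \<xi> \<alpha>"
    by blast
  moreover obtain r where "v (Poly_Mapping.lookup p \<alpha>) = ereal r"
    using \<alpha>(1) by (auto simp: in_keys_iff elim: v_finiteE)
  ultimately have "poly_val v \<xi> p = v (Poly_Mapping.lookup p \<alpha>) + ereal (pairing \<xi> \<alpha>)"
    using assms by (simp add: poly_val_def)
  then show ?thesis ..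
qed

lemma poly_val_geI:
  assumes "\<And>\<alpha>. t \<le> v (Poly_Mapping.lookup p \<alpha>) + ereal (pairing \<xi> \<alpha>)"
  shows "t \<le> poly_val v \<xi> p"
proof (cases "p = 0")
  case False
  then show ?thesis
    using ex_poly_val_eq[OF False, of \<xi>] assms by metis
qed (simp add: poly_val_def)

lemma poly_val_add: "min (poly_val v \<xi> p) (poly_val v \<xi> q) \<le> poly_val v \<xi> (p + q)"
proof (rule poly_val_geI)
  fix \<alpha>
  have "min (poly_val v \<xi> p) (poly_val v \<xi> q) \<le>
      min (v (Poly_Mapping.lookup p \<alpha>) + ereal (pairing \<xi> \<alpha>)) (v (Poly_Mapping.lookup q \<alpha>) + ereal (pairing \<xi> \<alpha>))"
    by (intro min.mono poly_val_le)
  also have "\<dots> = min (v (Poly_Mapping.lookup p \<alpha>)) (v (Poly_Mapping.lookup q \<alpha>)) + ereal (pairing \<xi> \<alpha>)"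
    by (auto simp: min_def ereal_add_le_add_iff2)
  also have "\<dots> \<le> v (Poly_Mapping.lookup (p + q) \<alpha>) + ereal (pairing \<xi> \<alpha>)"
    unfolding lookup_add by (intro add_right_mono v_add)
  finally show "min (poly_val v \<xi> p) (poly_val v \<xi> q) \<le> v (Poly_Mapping.lookup (p + q) \<alpha>) + ereal (pairing \<xi> \<alpha>)" .
qed

lemma poly_val_single: "poly_val v \<xi> (Poly_Mapping.single \<alpha> c) = v c + ereal (pairing \<xi> \<alpha>)"
proof (cases "c = 0")
  case False
  then obtain r where "v c = ereal r"
    by (rule v_finiteE)
  moreover have "Poly_Mapping.single \<alpha> c \<noteq> 0"
    using False by (metis lookup_single_eq lookup_zero)
  ultimately show ?thesis
    using False by (simp add: poly_val_def trop_poly_eq)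
qed (simp add: poly_val_def)

text \<open>The easy half of Gauss's lemma: every product of terms contributing to a coefficient
  satisfies the bound, hence so does their sum.\<close>

lemma poly_val_mult_ge: "poly_val v \<xi> p + poly_val v \<xi> q \<le> poly_val v \<xi> (p * q)"
proof (rule poly_val_geI)
  fix \<gamma>
  let ?t = "poly_val v \<xi> p + poly_val v \<xi> q - ereal (pairing \<xi> \<gamma>)"
  have "?t \<le> v (Poly_Mapping.lookup p \<alpha> * Poly_Mapping.lookup q \<beta>)" if "\<alpha> + \<beta> = \<gamma>" for \<alpha> \<beta>
  proof -
    have "poly_val v \<xi> p + poly_val v \<xi> q \<le> (v (Poly_Mapping.lookup p \<alpha>) + ereal (pairing \<xi> \<alpha>)) +
        (v (Poly_Mapping.lookup q \<beta>) + ereal (pairing \<xi> \<beta>))"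
      by (intro add_mono poly_val_le)
    also have "\<dots> = v (Poly_Mapping.lookup p \<alpha> * Poly_Mapping.lookup q \<beta>) + ereal (pairing \<xi> \<gamma>)"
      by (simp add: v_mult add_ac pairing_add flip: that plus_ereal.simps(1))
    finally show ?thesis
      by (simp add: ereal_minus_le_iff)
  qed
  then have "?t \<le> v (Poly_Mapping.lookup (p * q) \<gamma>)"
    unfolding lookup_mult_eq_sum by (intro v_sum_ge) auto
  then show "poly_val v \<xi> p + poly_val v \<xi> q \<le> v (Poly_Mapping.lookup (p * q) \<gamma>) + ereal (pairing \<xi> \<gamma>)"
    by (simp add: ereal_minus_le_iff)
qed

text \<open>Gauss's lemma: among the exponents attaining the minima, take the largest ones for a
  monomial order; the product of the corresponding terms is the only contribution of minimal
  valuation to its coefficient in \<open>p * q\<close>.\<close>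

lemma poly_val_mult: "poly_val v \<xi> (p * q) = poly_val v \<xi> p + poly_val v \<xi> q"
proof (cases "p = 0 \<or> q = 0")
  case True
  then show ?thesis by (auto simp: poly_val_def)
next
  case False
  define w where "w p \<alpha> = real_of_ereal (v (Poly_Mapping.lookup p \<alpha>)) + pairing \<xi> \<alpha>" for p \<alpha>
  have trop: "trop_poly v p \<xi> = Min (w p ` Poly_Mapping.keys p)" for p
    by (simp add: trop_poly_eq w_def)
  have ge: "trop_poly v p \<xi> \<le> w p \<alpha>" if "\<alpha> \<in> Poly_Mapping.keys p" for p \<alpha>
    unfolding trop using that by simp
  \<comment> \<open>The order on exponents is the lexicographic one on finitely supported functions.
    It is total, so a largest minimizing exponent exists.\<close>
  have ex: "\<exists>\<alpha>\<in>Poly_Mapping.keys p. w p \<alpha> = trop_poly v p \<xi> \<and>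
      (\<forall>\<beta>\<in>Poly_Mapping.keys p. w p \<beta> = trop_poly v p \<xi> \<longrightarrow> \<beta> \<le> \<alpha>)" if "p \<noteq> 0" for p
  proof -
    let ?A = "{\<alpha> \<in> Poly_Mapping.keys p. w p \<alpha> = trop_poly v p \<xi>}"
    have "trop_poly v p \<xi> \<in> w p ` Poly_Mapping.keys p"
      unfolding trop using that by (intro Min_in) auto
    then have "?A \<noteq> {}"
      by force
    then have "Max ?A \<in> ?A"
      by (intro Max_in) auto
    moreover have "\<beta> \<le> Max ?A" if "\<beta> \<in> ?A" for \<beta>
      using that by (intro Max_ge) auto
    ultimately show ?thesis
      by blast
  qed
  obtain \<alpha> where \<alpha>: "\<alpha> \<in> Poly_Mapping.keys p" "w p \<alpha> = trop_poly v p \<xi>"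
      "\<And>\<beta>. \<beta> \<in> Poly_Mapping.keys p \<Longrightarrow> w p \<beta> = trop_poly v p \<xi> \<Longrightarrow> \<beta> \<le> \<alpha>"
    using ex[of p] False by blast
  obtain \<beta> where \<beta>: "\<beta> \<in> Poly_Mapping.keys q" "w q \<beta> = trop_poly v q \<xi>"
      "\<And>\<gamma>. \<gamma> \<in> Poly_Mapping.keys q \<Longrightarrow> w q \<gamma> = trop_poly v q \<xi> \<Longrightarrow> \<gamma> \<le> \<beta>"
    using ex[of q] False by blast
  let ?t = "trop_poly v p \<xi> + trop_poly v q \<xi>"
  have v_prod: "v (Poly_Mapping.lookup p \<alpha>' * Poly_Mapping.lookup q \<beta>') = ereal (w p \<alpha>' + w q \<beta>' - pairing \<xi> (\<alpha> + \<beta>))"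
    if "\<alpha>' \<in> Poly_Mapping.keys p" "\<beta>' \<in> Poly_Mapping.keys q" "\<alpha>' + \<beta>' = \<alpha> + \<beta>" for \<alpha>' \<beta>'
  proof -
    have "v (Poly_Mapping.lookup p \<alpha>') = ereal (w p \<alpha>' - pairing \<xi> \<alpha>')"
      using v_finite[of "Poly_Mapping.lookup p \<alpha>'"] that by (simp add: w_def in_keys_iff)
    moreover have "v (Poly_Mapping.lookup q \<beta>') = ereal (w q \<beta>' - pairing \<xi> \<beta>')"
      using v_finite[of "Poly_Mapping.lookup q \<beta>'"] that by (simp add: w_def in_keys_iff)
    ultimately show ?thesis
      unfolding v_mult that(3)[symmetric] pairing_add by simp
  qed
  \<comment> \<open>Pairs with another sum of exponents get the term \<open>0\<close> of valuation
    \<open>\<infinity>\<close>, so the strict inequality below is immediate for them.\<close>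
  define T where "T = (\<lambda>(\<alpha>', \<beta>'). if \<alpha>' + \<beta>' = \<alpha> + \<beta> then Poly_Mapping.lookup p \<alpha>' * Poly_Mapping.lookup q \<beta>' else 0)"
  let ?I = "Poly_Mapping.keys p \<times> Poly_Mapping.keys q"
  have main: "v (T (\<alpha>, \<beta>)) = ereal (?t - pairing \<xi> (\<alpha> + \<beta>))"
    using v_prod[OF \<alpha>(1) \<beta>(1) refl] \<alpha>(2) \<beta>(2) by (simp add: T_def)
  have "ereal (?t - pairing \<xi> (\<alpha> + \<beta>)) < v (T i)" if "i \<in> ?I - {(\<alpha>, \<beta>)}" for i
  proof (cases "fst i + snd i = \<alpha> + \<beta>")
    case True
    obtain \<alpha>' \<beta>' where i: "i = (\<alpha>', \<beta>')" by (cases i)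
    have keys: "\<alpha>' \<in> Poly_Mapping.keys p" "\<beta>' \<in> Poly_Mapping.keys q" and ne: "\<alpha>' \<noteq> \<alpha> \<or> \<beta>' \<noteq> \<beta>"
      using that i by auto
    have eq: "\<alpha>' + \<beta>' = \<alpha> + \<beta>"
      using True i by simp
    \<comment> \<open>By maximality, a second minimizing pair would be at most
      \<open>(\<alpha>, \<beta>)\<close> in both components and smaller in one. Addition is strictly
      monotone, so its sum would be smaller.\<close>
    have "\<not> (w p \<alpha>' = trop_poly v p \<xi> \<and> w q \<beta>' = trop_poly v q \<xi>)"
    proof
      assume "w p \<alpha>' = trop_poly v p \<xi> \<and> w q \<beta>' = trop_poly v q \<xi>"
      then have le: "\<alpha>' \<le> \<alpha>" "\<beta>' \<le> \<beta>"
        using \<alpha>(3) \<beta>(3) keys by auto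
      then have "\<alpha>' + \<beta>' < \<alpha> + \<beta>"
        using ne by (metis add_le_less_mono add_less_le_mono order_le_less)
      then show False using eq by simp
    qed
    then have "?t < w p \<alpha>' + w q \<beta>'"
      using ge[OF keys(1)] ge[OF keys(2)] by linarith
    then show ?thesis
      using v_prod[OF keys eq] eq by (simp add: T_def i)
  qed (auto simp: T_def split: prod.splits)
  then have rest: "v (T (\<alpha>, \<beta>)) < v (\<Sum>i\<in>?I - {(\<alpha>, \<beta>)}. T i)"
    unfolding main by (intro v_sum_gt) auto
  have "Poly_Mapping.lookup (p * q) (\<alpha> + \<beta>) = (\<Sum>i\<in>?I. T i)"
    by (simp add: lookup_mult_eq_sum T_def)
  also have "\<dots> = T (\<alpha>, \<beta>) + (\<Sum>i\<in>?I - {(\<alpha>, \<beta>)}. T i)"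
    using \<alpha>(1) \<beta>(1) by (intro sum.remove) auto
  finally have "v (Poly_Mapping.lookup (p * q) (\<alpha> + \<beta>)) = ereal (?t - pairing \<xi> (\<alpha> + \<beta>))"
    using v_add_eq[OF rest] main by simp
  then have "poly_val v \<xi> (p * q) \<le> ereal ?t"
    using poly_val_le[of \<xi> "p * q" "\<alpha> + \<beta>"] by simp
  moreover have "poly_val v \<xi> p + poly_val v \<xi> q = ereal ?t"
    using False by (simp add: poly_val_def)
  ultimately show ?thesis
    using poly_val_mult_ge[of \<xi> p q] by (intro antisym) auto
qed

text \<open>Independence of the quotient: cross-multiply and apply Gauss's lemma. Denominators have
  finite values, so they can be cancelled in \<open>ereal\<close>.\<close>

lemma rat_val_Fract:
  assumes "b \<noteq> 0"
  shows "rat_val v \<xi> (Fract a b) = poly_val v \<xi> a - poly_val v \<xi> b"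
  unfolding rat_val_def
proof (rule the_equality)
  show "\<exists>a' b'. b' \<noteq> 0 \<and> Fract a b = Fract a' b' \<and> poly_val v \<xi> a - poly_val v \<xi> b = poly_val v \<xi> a' - poly_val v \<xi> b'"
    using assms by blast
next
  fix t
  assume "\<exists>c d. d \<noteq> 0 \<and> Fract a b = Fract c d \<and> t = poly_val v \<xi> c - poly_val v \<xi> d"
  then obtain c d where d: "d \<noteq> 0" and "Fract a b = Fract c d" and t: "t = poly_val v \<xi> c - poly_val v \<xi> d"
    by blast
  then have "a * d = c * b"
    using assms by (simp add: eq_fract)
  then have "poly_val v \<xi> a + poly_val v \<xi> d = poly_val v \<xi> c + poly_val v \<xi> b"
    by (metis poly_val_mult)
  moreover obtain r s where "poly_val v \<xi> b = ereal r" "poly_val v \<xi> d = ereal s"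
    using assms d by (simp add: poly_val_def)
  ultimately show "t = poly_val v \<xi> a - poly_val v \<xi> b"
    unfolding t by (cases "poly_val v \<xi> a"; cases "poly_val v \<xi> c") auto
qed

text \<open>Products are Gauss's lemma for numerators and denominators. Sums are brought to the
  common denominator \<open>b * d\<close>, whose value \<open>r + s\<close> is finite, and reduce to
  \<open>poly_val_add\<close>.\<close>

lemma valuation_rat_val: "valuation (rat_val v \<xi>)"
  unfolding valuation_def
proof (intro conjI allI)
  have rat_val_cases: "\<exists>a b r. f = Fract a b \<and> b \<noteq> 0 \<and> poly_val v \<xi> b = ereal r \<and>
      rat_val v \<xi> f = poly_val v \<xi> a - ereal r" for f
  proof -
    obtain a b where "f = Fract a b" "b \<noteq> 0"
      by (rule Fract_cases)
    then show ?thesis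
      using rat_val_Fract[of b \<xi> a] by (auto simp: poly_val_def)
  qed
  fix f g :: "'k ratfun"
  obtain a b r where f: "f = Fract a b" "b \<noteq> 0" "poly_val v \<xi> b = ereal r" "rat_val v \<xi> f = poly_val v \<xi> a - ereal r"
    using rat_val_cases by blast
  obtain c d s where g: "g = Fract c d" "d \<noteq> 0" "poly_val v \<xi> d = ereal s" "rat_val v \<xi> g = poly_val v \<xi> c - ereal s"
    using rat_val_cases by blast
  have bd: "b * d \<noteq> 0"
    using f(2) g(2) by simp
  show "rat_val v \<xi> f \<noteq> -\<infinity>"
    using f(4) poly_val_not_MInfty[of \<xi> a] by (cases "poly_val v \<xi> a") auto
  have "rat_val v \<xi> f = \<infinity> \<longleftrightarrow> a = 0"
    using f(4) poly_val_eq_PInfty_iff[of \<xi> a] by (cases "poly_val v \<xi> a") auto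
  then show "rat_val v \<xi> f = \<infinity> \<longleftrightarrow> f = 0"
    using f(1,2) by (simp add: Zero_fract_def eq_fract)
  have "rat_val v \<xi> (f * g) = poly_val v \<xi> a + poly_val v \<xi> c - ereal (r + s)"
    unfolding f(1) g(1) mult_fract using bd f(3) g(3) by (simp add: rat_val_Fract poly_val_mult)
  also have "\<dots> = rat_val v \<xi> f + rat_val v \<xi> g"
    unfolding f(4) g(4) by (cases "poly_val v \<xi> a"; cases "poly_val v \<xi> c") auto
  finally show "rat_val v \<xi> (f * g) = rat_val v \<xi> f + rat_val v \<xi> g" .
  have "rat_val v \<xi> (f + g) = poly_val v \<xi> (a * d + c * b) - ereal (r + s)"
    unfolding f(1) g(1) add_fract[OF f(2) g(2)] using bd f(3) g(3)
    by (simp add: rat_val_Fract poly_val_mult)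
  also have "\<dots> \<ge> min (poly_val v \<xi> a + ereal s) (poly_val v \<xi> c + ereal r) - ereal (r + s)"
    using poly_val_add[of \<xi> "a * d" "c * b"] f(3) g(3) by (intro ereal_minus_mono) (auto simp: poly_val_mult)
  also have "min (poly_val v \<xi> a + ereal s) (poly_val v \<xi> c + ereal r) - ereal (r + s) = min (rat_val v \<xi> f) (rat_val v \<xi> g)"
    unfolding f(4) g(4) by (cases "poly_val v \<xi> a"; cases "poly_val v \<xi> c") (auto simp: min_def)
  finally show "min (rat_val v \<xi> f) (rat_val v \<xi> g) \<le> rat_val v \<xi> (f + g)" .
qed

lemma rat_val_const: "rat_val v \<xi> (const_rat c) = v c"
proof -
  have "poly_val v \<xi> 1 = 0"
    using poly_val_single[of \<xi> 0 1] by simp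
  then show ?thesis
    by (simp add: const_rat_def rat_val_Fract poly_val_single)
qed

lemma rat_val_var: "rat_val v \<xi> (Fract (Poly_Mapping.single (Poly_Mapping.single i 1) 1) 1) = ereal (\<xi> i)"
proof -
  have "poly_val v \<xi> 1 = 0"
    using poly_val_single[of \<xi> 0 1] by simp
  then show ?thesis
    by (simp add: rat_val_Fract poly_val_single)
qed

text \<open>Used to move the coordinate of the fresh variable without affecting functions of the
  other variables.\<close>

lemma rat_val_cong:
  assumes "f \<in> ratfuns m" and "\<And>i. i < m \<Longrightarrow> \<xi> i = \<xi>' i"
  shows "rat_val v \<xi> f = rat_val v \<xi>' f"
proof -
  obtain a b where ab: "f = Fract a b" "a \<in> polys m" "b \<in> polys m" "b \<noteq> 0"
    using assms(1) by (rule ratfunsE)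
  have "poly_val v \<xi> a = poly_val v \<xi>' a" "poly_val v \<xi> b = poly_val v \<xi>' b"
    using ab assms(2) by (auto intro: poly_val_cong)
  then show ?thesis
    using ab by (simp add: rat_val_Fract)
qed

text \<open>The bridge back to the statement: on non-zero functions of \<open>m\<close> variables,
  every admissible quotient gives the same real number.\<close>

lemma rat_val_eq_trop_rat:
  assumes "f \<in> ratfuns m" "f \<noteq> 0"
  shows "rat_val v \<xi> f = ereal (trop_rat v m f \<xi>)"
proof -
  have "trop_rat v m f \<xi> = real_of_ereal (rat_val v \<xi> f)"
    unfolding trop_rat_def
  proof (rule the_equality)
    obtain a b where "f = Fract a b" "a \<in> polys m" "b \<in> polys m" "b \<noteq> 0" "a \<noteq> 0"
      using assms by (rule ratfuns_nonzeroE)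
    then show "\<exists>a b. is_quotient m f a b \<and> a \<noteq> 0 \<and>
        real_of_ereal (rat_val v \<xi> f) = trop_poly v a \<xi> - trop_poly v b \<xi>"
      by (intro exI[of _ a] exI[of _ b]) (simp add: is_quotient_def rat_val_Fract poly_val_def)
  qed (auto simp: is_quotient_def rat_val_Fract poly_val_def)
  moreover have "rat_val v \<xi> f = ereal (real_of_ereal (rat_val v \<xi> f))"
    using assms(2) valued_field.v_finite[of "rat_val v \<xi>" f] valuation_rat_val
    by (simp add: valued_field_def)
  ultimately show ?thesis
    by simp
qed

end

subsection \<open>Perturbation of rational maps\<close>

text \<open>The functions are fixed while the valuation varies with \<open>k\<close>. The lower
  bound on \<open>g\<close> makes the notion stable under products; the linear rate absorbs bounded
  losses into \<open>C\<close>.\<close>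

definition approximates :: "(nat \<Rightarrow> 'a::field \<Rightarrow> ereal) \<Rightarrow> 'a \<Rightarrow> 'a \<Rightarrow> bool" where
  "approximates w f g \<longleftrightarrow> (\<exists>C. \<forall>k. ereal (real k - C) \<le> w k (f - g) \<and> ereal (- C) \<le> w k g)"

locale valuation_sequence =
  fixes w :: "nat \<Rightarrow> 'a::field \<Rightarrow> ereal"
  assumes valuations: "valuation (w k)"
begin

sublocale w: valued_field "w k" for k
  by unfold_locales (rule valuations)

lemma approximates_refl: "(\<And>k. ereal (- C) \<le> w k g) \<Longrightarrow> approximates w g g"
  unfolding approximates_def by auto

lemma approximates_add:
  assumes "approximates w f g" "approximates w f' g'"
  shows "approximates w (f + f') (g + g')"
proof -
  obtain C where C: "\<And>k. ereal (real k - C) \<le> w k (f - g)" "\<And>k. ereal (- C) \<le> w k g"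
    using assms(1) unfolding approximates_def by blast
  obtain C' where C': "\<And>k. ereal (real k - C') \<le> w k (f' - g')" "\<And>k. ereal (- C') \<le> w k g'"
    using assms(2) unfolding approximates_def by blast
  have "ereal (real k - max C C') \<le> w k ((f + f') - (g + g'))" for k
  proof -
    have "ereal (real k - max C C') \<le> min (w k (f - g)) (w k (f' - g'))"
      using C(1)[of k] C'(1)[of k] by (auto intro: order_trans[rotated])
    also have "\<dots> \<le> w k ((f - g) + (f' - g'))"
      by (rule w.v_add)
    finally show ?thesis
      by (simp add: algebra_simps)
  qed
  moreover have "ereal (- max C C') \<le> w k (g + g')" for k
  proof -
    have "ereal (- max C C') \<le> min (w k g) (w k g')"
      using C(2)[of k] C'(2)[of k] by (auto intro: order_trans[rotated])
    also have "\<dots> \<le> w k (g + g')"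
      by (rule w.v_add)
    finally show ?thesis .
  qed
  ultimately show ?thesis
    unfolding approximates_def by blast
qed

text \<open>Uses \<open>f * f' - g * g' = (f - g) * f' + g * (f' - g')\<close>, where
  \<open>f'\<close> and \<open>g\<close> have valuations bounded below.\<close>

lemma approximates_mult:
  assumes "approximates w f g" "approximates w f' g'"
  shows "approximates w (f * f') (g * g')"
proof -
  obtain C where C: "\<And>k. ereal (real k - C) \<le> w k (f - g)" "\<And>k. ereal (- C) \<le> w k g"
    using assms(1) unfolding approximates_def by blast
  obtain C' where C': "\<And>k. ereal (real k - C') \<le> w k (f' - g')" "\<And>k. ereal (- C') \<le> w k g'"
    using assms(2) unfolding approximates_def by blast
  have "ereal (real k - (C + C')) \<le> w k (f * f' - g * g')" for k
  proof -
    \<comment> \<open>As \<open>k\<close> is non-negative, the difference is bounded below too, and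
      so is \<open>f' = (f' - g') + g'\<close>.\<close>
    have "ereal (- C') \<le> w k (f' - g')"
      using C'(1)[of k] by (rule order_trans[rotated]) simp
    then have "ereal (- C') \<le> min (w k (f' - g')) (w k g')"
      using C'(2)[of k] by simp
    also have "\<dots> \<le> w k f'"
      using w.v_add[of k "f' - g'" g'] by simp
    finally have "ereal (real k - C) + ereal (- C') \<le> w k ((f - g) * f')"
      unfolding w.v_mult by (intro add_mono C(1))
    moreover have "ereal (- C) + ereal (real k - C') \<le> w k (g * (f' - g'))"
      unfolding w.v_mult by (intro add_mono C C')
    ultimately have "ereal (real k - (C + C')) \<le> min (w k ((f - g) * f')) (w k (g * (f' - g')))"
      by (simp add: algebra_simps)
    also have "\<dots> \<le> w k ((f - g) * f' + g * (f' - g'))"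
      by (rule w.v_add)
    finally show ?thesis
      by (simp add: algebra_simps)
  qed
  moreover have "ereal (- (C + C')) \<le> w k (g * g')" for k
    using add_mono[OF C(2)[of k] C'(2)[of k]] by (simp add: w.v_mult)
  ultimately show ?thesis
    unfolding approximates_def by blast
qed

lemma approximates_1: "approximates w 1 1"
  by (rule approximates_refl[of 0]) simp

lemma approximates_0: "approximates w 0 0"
  by (rule approximates_refl[of 0]) simp

lemma approximates_power: "approximates w f g \<Longrightarrow> approximates w (f ^ n) (g ^ n)"
  by (induction n) (auto intro: approximates_1 approximates_mult)

lemma approximates_sum:
  "(\<And>i. i \<in> A \<Longrightarrow> approximates w (f i) (g i)) \<Longrightarrow> approximates w (\<Sum>i\<in>A. f i) (\<Sum>i\<in>A. g i)"
  by (induction A rule: infinite_finite_induct) (auto intro: approximates_0 approximates_add)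

lemma approximates_prod:
  "(\<And>i. i \<in> A \<Longrightarrow> approximates w (f i) (g i)) \<Longrightarrow> approximates w (\<Prod>i\<in>A. f i) (\<Prod>i\<in>A. g i)"
  by (induction A rule: infinite_finite_induct) (auto intro: approximates_1 approximates_mult)

text \<open>As soon as \<open>k > r + C\<close>, the difference \<open>f - g\<close> has larger
  valuation than \<open>g\<close>, and the strict form of the ultrametric inequality
  applies.\<close>

lemma approximates_imp_eventually_eq:
  assumes "approximates w f g" and "\<And>k. w k g = ereal r"
  shows "\<forall>\<^sub>F k in sequentially. w k f = ereal r"
proof -
  obtain C where C: "\<And>k. ereal (real k - C) \<le> w k (f - g)"
    using assms(1) unfolding approximates_def by blast
  have "\<forall>\<^sub>F k in sequentially. r + C < real k"
    using filterlim_real_sequentially by (simp add: filterlim_at_top_dense)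
  then show ?thesis
  proof eventually_elim
    case (elim k)
    then have "w k g < ereal (real k - C)"
      by (simp add: assms(2) less_diff_eq)
    then have "w k g < w k (f - g)"
      using C[of k] by (rule less_le_trans)
    then have "w k (g + (f - g)) = w k g"
      by (rule w.v_add_eq)
    then show ?case
      by (simp add: assms(2))
  qed
qed

end

context valued_field
begin

lemma valuation_sequence_rat_val: "valuation_sequence (\<lambda>k. rat_val v (\<Xi> k))"
  by unfold_locales (rule valuation_rat_val)

lemma valued_field_rat_val: "valued_field (rat_val v \<xi>)"
  by unfold_locales (rule valuation_rat_val)

text \<open>Approximation passes through sums and products, and constants approximate themselves
  because their valuation does not depend on \<open>k\<close>.\<close>

lemma approximates_subst_poly:
  assumes a: "a \<in> polys m"
    and approx: "\<And>i. i < m \<Longrightarrow> approximates (\<lambda>k. rat_val v (\<Xi> k)) (\<alpha> i) (\<beta> i)"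
  shows "approximates (\<lambda>k. rat_val v (\<Xi> k)) (subst_poly \<alpha> a) (subst_poly \<beta> a)"
proof -
  interpret valuation_sequence "\<lambda>k. rat_val v (\<Xi> k)"
    by (rule valuation_sequence_rat_val)
  have const: "approximates (\<lambda>k. rat_val v (\<Xi> k)) (const_rat c) (const_rat c)" for c
  proof (cases "c = 0")
    case False
    then obtain r where "v c = ereal r"
      by (rule v_finiteE)
    then show ?thesis
      by (intro approximates_refl[of "- r"]) (simp add: rat_val_const)
  qed (simp add: subst_poly.hom_0 approximates_0)
  show ?thesis
    unfolding eval_with_def using a
    by (intro approximates_sum approximates_mult approximates_prod approximates_power const approx)
      (auto simp: polys_def)
qed

text \<open>The limit \<open>subst_poly \<beta> a\<close> involves only variables whose weights are
  constant in \<open>k\<close>; being non-zero, it has one finite valuation for all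
  \<open>k\<close>.\<close>

lemma eventually_rat_val_subst_poly:
  assumes a: "a \<in> polys m"
    and approx: "\<And>i. i < m \<Longrightarrow> approximates (\<lambda>k. rat_val v (\<Xi> k)) (\<alpha> i) (\<beta> i)"
    and \<beta>: "\<And>i. i < m \<Longrightarrow> \<beta> i \<in> ratfuns p"
    and nz: "subst_poly \<beta> a \<noteq> 0"
    and \<Xi>: "\<And>k i. i < p \<Longrightarrow> \<Xi> k i = \<xi> i"
  shows "\<forall>\<^sub>F k in sequentially. rat_val v (\<Xi> k) (subst_poly \<alpha> a) = rat_val v \<xi> (subst_poly \<beta> a)"
proof -
  obtain r where r: "rat_val v \<xi> (subst_poly \<beta> a) = ereal r"
    using nz by (rule valued_field.v_finiteE[OF valued_field_rat_val])
  have eq: "rat_val v (\<Xi> k) (subst_poly \<beta> a) = ereal r" for k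
    unfolding r[symmetric] by (rule rat_val_cong[OF ratfuns_subst_poly[OF a \<beta>]]) (simp_all add: \<Xi>)
  interpret valuation_sequence "\<lambda>k. rat_val v (\<Xi> k)"
    by (rule valuation_sequence_rat_val)
  show ?thesis
    unfolding r using approximates_subst_poly[OF a approx] eq
    by (rule approximates_imp_eventually_eq)
qed

end

section \<open>Composition of rational maps and inclusion of tropical images\<close>

text \<open>Substitution is a ring homomorphism, so two quotients with surviving denominators agree
  after cross-multiplication.\<close>

lemma subst_rat_eq:
  assumes "a \<in> polys m" "b \<in> polys m" "subst_poly \<alpha> b \<noteq> 0"
  shows "subst_rat m \<alpha> (Fract a b) = subst_poly \<alpha> a / subst_poly \<alpha> b"
  unfolding subst_rat_def
proof (rule the_equality)
  have b: "b \<noteq> 0"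
    using assms(3) by auto
  then show "\<exists>c d. is_quotient m (Fract a b) c d \<and> subst_poly \<alpha> d \<noteq> 0 \<and>
      subst_poly \<alpha> a / subst_poly \<alpha> b = subst_poly \<alpha> c / subst_poly \<alpha> d"
    using assms by (intro exI[of _ a] exI[of _ b]) (simp add: is_quotient_def)
  fix g
  assume "\<exists>c d. is_quotient m (Fract a b) c d \<and> subst_poly \<alpha> d \<noteq> 0 \<and>
      g = subst_poly \<alpha> c / subst_poly \<alpha> d"
  then obtain c d where cd: "d \<noteq> 0" "Fract a b = Fract c d" "subst_poly \<alpha> d \<noteq> 0"
      "g = subst_poly \<alpha> c / subst_poly \<alpha> d"
    by (auto simp: is_quotient_def)
  then have "a * d = c * b"
    using b by (simp add: eq_fract)
  then have "subst_poly \<alpha> a * subst_poly \<alpha> d = subst_poly \<alpha> c * subst_poly \<alpha> b"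
    by (metis subst_poly.eval_with_mult)
  then show "g = subst_poly \<alpha> a / subst_poly \<alpha> b"
    unfolding cd(4) using cd(3) assms(3) by (simp add: frac_eq_eq)
qed

text \<open>Numerator and denominator of each component of \<open>\<phi>\<close> eventually have the
  same valuation after either substitution. The point \<open>\<Xi> k\<close> for one large
  \<open>k\<close> then has the desired image.\<close>

lemma (in valued_field) im_trop_subset:
  fixes \<phi> :: "nat \<Rightarrow> 'k ratfun"
  assumes \<phi>: "rational_map m n \<phi>"
    and \<alpha>: "\<And>i. i < m \<Longrightarrow> \<alpha> i \<in> ratfuns q" "\<And>a. a \<in> polys m \<Longrightarrow> a \<noteq> 0 \<Longrightarrow> subst_poly \<alpha> a \<noteq> 0"
    and \<beta>: "\<And>i. i < m \<Longrightarrow> \<beta> i \<in> ratfuns p" "\<And>a. a \<in> polys m \<Longrightarrow> a \<noteq> 0 \<Longrightarrow> subst_poly \<beta> a \<noteq> 0"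
    and approx: "\<And>\<xi> :: nat \<Rightarrow> real. \<exists>\<Xi>. (\<forall>k. \<forall>i<p. \<Xi> k i = \<xi> i) \<and>
      (\<forall>i<m. approximates (\<lambda>k. rat_val v (\<Xi> k)) (\<alpha> i) (\<beta> i))"
  shows "im_trop v p n (rational_comp m n \<phi> \<beta>) \<subseteq> im_trop v q n (rational_comp m n \<phi> \<alpha>)"
proof
  fix y assume "y \<in> im_trop v p n (rational_comp m n \<phi> \<beta>)"
  then obtain \<xi> where \<xi>: "y = trop_map v p n (rational_comp m n \<phi> \<beta>) \<xi>"
    unfolding im_trop_def by blast
  obtain \<Xi> where \<Xi>: "\<And>k i. i < p \<Longrightarrow> \<Xi> k i = \<xi> i"
      "\<And>i. i < m \<Longrightarrow> approximates (\<lambda>k. rat_val v (\<Xi> k)) (\<alpha> i) (\<beta> i)"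
    using approx[of \<xi>] by blast
  have "\<forall>\<^sub>F k in sequentially. trop_rat v q (subst_rat m \<alpha> (\<phi> j)) (\<Xi> k) =
      trop_rat v p (subst_rat m \<beta> (\<phi> j)) \<xi>" if "j < n" for j
  proof -
    have "\<phi> j \<in> ratfuns m" "\<phi> j \<noteq> 0"
      using \<phi> that by (auto simp: rational_map_def)
    then obtain a b where ab: "\<phi> j = Fract a b" "a \<in> polys m" "b \<in> polys m" "b \<noteq> 0" "a \<noteq> 0"
      by (rule ratfuns_nonzeroE)
    note nz = \<alpha>(2)[OF ab(2,5)] \<alpha>(2)[OF ab(3,4)] \<beta>(2)[OF ab(2,5)] \<beta>(2)[OF ab(3,4)]
    have "\<forall>\<^sub>F k in sequentially. rat_val v (\<Xi> k) (subst_poly \<alpha> a) = rat_val v \<xi> (subst_poly \<beta> a)"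
      "\<forall>\<^sub>F k in sequentially. rat_val v (\<Xi> k) (subst_poly \<alpha> b) = rat_val v \<xi> (subst_poly \<beta> b)"
      using ab nz \<beta>(1) \<Xi> by (auto intro!: eventually_rat_val_subst_poly[of _ m])
    then show ?thesis
    proof eventually_elim
      case (elim k)
      have "rat_val v (\<Xi> k) (subst_poly \<alpha> a / subst_poly \<alpha> b) = rat_val v \<xi> (subst_poly \<beta> a / subst_poly \<beta> b)"
        using elim nz by (simp add: valued_field.v_divide[OF valued_field_rat_val])
      moreover have "subst_poly \<alpha> a / subst_poly \<alpha> b \<in> ratfuns q" "subst_poly \<beta> a / subst_poly \<beta> b \<in> ratfuns p"
        using ab \<alpha>(1) \<beta>(1) by (auto intro!: ratfuns_divide ratfuns_subst_poly)
      ultimately show ?case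
        using ab nz by (simp add: subst_rat_eq rat_val_eq_trop_rat)
    qed
  qed
  \<comment> \<open>There are finitely many components, so a single \<open>k\<close> serves all of
    them.\<close>
  then have "\<forall>\<^sub>F k in sequentially. \<forall>j\<in>{..<n}. trop_rat v q (subst_rat m \<alpha> (\<phi> j)) (\<Xi> k) =
      trop_rat v p (subst_rat m \<beta> (\<phi> j)) \<xi>"
    by (intro eventually_ball_finite) auto
  then obtain k where k: "\<And>j. j < n \<Longrightarrow> trop_rat v q (subst_rat m \<alpha> (\<phi> j)) (\<Xi> k) =
      trop_rat v p (subst_rat m \<beta> (\<phi> j)) \<xi>"
    using eventually_happens'[OF sequentially_bot] by blast
  \<comment> \<open>Points of the domain are extensional, whereas \<open>\<Xi> k\<close> is
    arbitrary beyond \<open>q\<close>. Functions of \<open>q\<close> variables do not see the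
    difference.\<close>
  have restr: "trop_rat v q (subst_rat m \<alpha> (\<phi> j)) (restrict (\<Xi> k) {..<q}) =
      trop_rat v q (subst_rat m \<alpha> (\<phi> j)) (\<Xi> k)" if "j < n" for j
  proof -
    have "\<phi> j \<in> ratfuns m" "\<phi> j \<noteq> 0"
      using \<phi> that by (auto simp: rational_map_def)
    then obtain a b where ab: "\<phi> j = Fract a b" "a \<in> polys m" "b \<in> polys m" "b \<noteq> 0" "a \<noteq> 0"
      by (rule ratfuns_nonzeroE)
    note nz = \<alpha>(2)[OF ab(2,5)] \<alpha>(2)[OF ab(3,4)]
    have "subst_poly \<alpha> a / subst_poly \<alpha> b \<in> ratfuns q"
      using ab \<alpha>(1) by (auto intro!: ratfuns_divide ratfuns_subst_poly)
    moreover from this have "rat_val v (restrict (\<Xi> k) {..<q}) (subst_poly \<alpha> a / subst_poly \<alpha> b) =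
        rat_val v (\<Xi> k) (subst_poly \<alpha> a / subst_poly \<alpha> b)"
      by (rule rat_val_cong) simp
    ultimately show ?thesis
      using ab nz by (simp add: subst_rat_eq rat_val_eq_trop_rat)
  qed
  have "y = trop_map v q n (rational_comp m n \<phi> \<alpha>) (restrict (\<Xi> k) {..<q})"
    unfolding \<xi> trop_map_def
  proof (rule restrict_ext)
    fix j assume "j \<in> {..<n}"
    then show "trop_rat v p (rational_comp m n \<phi> \<beta> j) \<xi> =
        trop_rat v q (rational_comp m n \<phi> \<alpha> j) (restrict (\<Xi> k) {..<q})"
      by (simp add: rational_comp_def restr k)
  qed
  then show "y \<in> im_trop v q n (rational_comp m n \<phi> \<alpha>)"
    unfolding im_trop_def by (intro image_eqI[of _ _ "restrict (\<Xi> k) {..<q}"]) simp_all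
qed

section \<open>The interpolating map\<close>

text \<open>Here \<open>h\<close> is \<open>f\<close> moved towards \<open>g\<close> by the small
  factor \<open>s\<close>. The valuations of \<open>f\<close> and \<open>g - f\<close> do not depend
  on \<open>k\<close>, so that of \<open>h - f\<close> grows like that of \<open>s\<close>.\<close>

lemma (in valued_field) approximates_perturbation:
  assumes f: "f \<in> ratfuns N" and g: "g \<in> ratfuns N"
    and \<Xi>: "\<And>k i. i < N \<Longrightarrow> \<Xi> k i = \<xi> i"
    and s: "\<And>k. rat_val v (\<Xi> k) s = ereal (real k + 1)"
    and h: "h - f = s * (g - f)"
  shows "approximates (\<lambda>k. rat_val v (\<Xi> k)) h f"
proof -
  have bound: "\<exists>C. \<forall>k. ereal (- C) \<le> rat_val v (\<Xi> k) d" if "d \<in> ratfuns N" for d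
  proof -
    have eq: "rat_val v (\<Xi> k) d = rat_val v \<xi> d" for k
      using that by (rule rat_val_cong) (simp add: \<Xi>)
    have "rat_val v \<xi> d \<noteq> -\<infinity>"
      using valued_field.not_MInfty[OF valued_field_rat_val] .
    then show ?thesis
      unfolding eq by (cases "rat_val v \<xi> d") (auto intro: exI[of _ "- _"])
  qed
  obtain C where C: "\<And>k. ereal (- C) \<le> rat_val v (\<Xi> k) f"
    using bound[OF f] by blast
  obtain D where D: "\<And>k. ereal (- D) \<le> rat_val v (\<Xi> k) (g - f)"
    using bound[OF ratfuns_diff[OF g f]] by blast
  have "ereal (real k - max C D) \<le> rat_val v (\<Xi> k) (h - f) \<and> ereal (- max C D) \<le> rat_val v (\<Xi> k) f" for k
  proof
    have "ereal (real k - max C D) \<le> ereal (real k + 1) + ereal (- D)"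
      by simp
    also have "\<dots> \<le> rat_val v (\<Xi> k) (h - f)"
      unfolding h valued_field.v_mult[OF valued_field_rat_val] s by (intro add_left_mono D)
    finally show "ereal (real k - max C D) \<le> rat_val v (\<Xi> k) (h - f)" .
    show "ereal (- max C D) \<le> rat_val v (\<Xi> k) f"
      using C[of k] by (rule order_trans[rotated]) simp
  qed
  then show ?thesis
    unfolding approximates_def by blast
qed

theorem lemma3p5:
  fixes v :: "'k::alg_closed_field \<Rightarrow> ereal"
    and n m p1 p2 :: nat
    and X :: "(nat \<Rightarrow> 'k) set"
    and \<phi> \<alpha>1 \<alpha>2 :: "nat \<Rightarrow> 'k ratfun"
  assumes "valuation v"
    and "zariski_closed n X"
    and "dominant_map m n \<phi> X"
    and "dominant_map p1 m \<alpha>1 (torus m)"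
    and "dominant_map p2 m \<alpha>2 (torus m)"
  shows "\<exists>\<alpha> :: nat \<Rightarrow> 'k ratfun.
           dominant_map (p1 + p2 + 1) m \<alpha> (torus m) \<and>
           im_trop v p1 n (rational_comp m n \<phi> \<alpha>1)
             \<subseteq> im_trop v (p1 + p2 + 1) n (rational_comp m n \<phi> \<alpha>) \<and>
           im_trop v p2 n (rational_comp m n \<phi> \<alpha>2)
             \<subseteq> im_trop v (p1 + p2 + 1) n (rational_comp m n \<phi> \<alpha>)"
proof -
  interpret valued_field v
    using assms(1) by unfold_locales
  let ?N = "p1 + p2"
  \<comment> \<open>The last of the \<open>p1 + p2 + 1\<close> variables: its index is at least
    \<open>p1\<close> and \<open>p2\<close>, so it occurs in neither \<open>\<alpha>1\<close> nor
    \<open>\<alpha>2\<close>.\<close>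
  define t :: "'k ratfun" where "t = Fract (Poly_Mapping.single (Poly_Mapping.single ?N 1) 1) 1"
  define \<alpha> where "\<alpha> = (\<lambda>i\<in>{..<m}. (\<alpha>1 i + t * \<alpha>2 i) / (1 + t))"
  \<comment> \<open>The sign \<open>\<sigma>\<close> selects the direction in which the
    \<open>t\<close>-coordinate escapes. The shift to \<open>k + 1\<close> keeps it non-zero already
    for \<open>k = 0\<close>, so that \<open>1 + t\<close> has a dominant term.\<close>
  define \<Xi> :: "nat \<Rightarrow> (nat \<Rightarrow> real) \<Rightarrow> real \<Rightarrow> nat \<Rightarrow> nat \<Rightarrow> real" where
    "\<Xi> p \<xi> \<sigma> k i = (if i = ?N then \<sigma> * (real k + 1) else if i < p then \<xi> i else 0)" for p \<xi> \<sigma> k i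
  have t: "rat_val v \<xi> t = ereal (\<xi> ?N)" for \<xi>
    unfolding t_def by (rule rat_val_var)
  have t_rat: "t \<in> ratfuns (?N + 1)"
    unfolding t_def by (intro ratfunsI polys_single) auto
  have \<alpha>1: "\<alpha>1 i \<in> ratfuns p1" and \<alpha>2: "\<alpha>2 i \<in> ratfuns p2" if "i < m" for i
    using assms(4,5) that by (auto simp: dominant_map_def rational_map_def)
  have nz1: "subst_poly \<alpha>1 a \<noteq> 0" and nz2: "subst_poly \<alpha>2 a \<noteq> 0" if "a \<in> polys m" "a \<noteq> 0" for a
    using dominant_imp_subst_poly_nonzero assms(4,5) that by blast+
  have \<alpha>_rat: "\<alpha> i \<in> ratfuns (?N + 1)" if "i < m" for i
    using that \<alpha>1[OF that] \<alpha>2[OF that] t_rat unfolding \<alpha>_def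
    by (simp add: ratfuns_divide ratfuns_add ratfuns_mult ratfuns_mono[of p1 "Suc ?N"] ratfuns_mono[of p2 "Suc ?N"])
  have \<alpha>12: "\<alpha>1 i \<in> ratfuns ?N" "\<alpha>2 i \<in> ratfuns ?N" if "i < m" for i
    using \<alpha>1[OF that] \<alpha>2[OF that] by (auto intro: ratfuns_mono[rotated])
  have val1: "rat_val v \<xi> 1 = 0" for \<xi>
    by (rule valued_field.v_1[OF valued_field_rat_val])
  have v_1t_pos: "rat_val v \<xi> (1 + t) = 0" if "\<xi> ?N > 0" for \<xi>
    using valued_field.v_add_eq[OF valued_field_rat_val, of \<xi> 1 t] that by (simp add: val1 t)
  have v_1t_neg: "rat_val v \<xi> (1 + t) = ereal (\<xi> ?N)" if "\<xi> ?N < 0" for \<xi>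
    using valued_field.v_add_eq[OF valued_field_rat_val, of \<xi> t 1] that by (simp add: val1 t add.commute)
  \<comment> \<open>Its valuation at the point with all coordinates \<open>1\<close> is
    \<open>0\<close> and not \<open>\<infinity>\<close>.\<close>
  have "1 + t \<noteq> 0"
    using v_1t_pos[of "\<lambda>_. 1"] valued_field.v_0[OF valued_field_rat_val, of "\<lambda>_. 1"] by auto
  note v_divide' = valued_field.v_divide[OF valued_field_rat_val this]
  \<comment> \<open>For a positive \<open>t\<close>-coordinate, \<open>1 + t\<close> has valuation
    \<open>0\<close>, and the factor \<open>t / (1 + t)\<close> inherits the valuation
    \<open>k + 1\<close> of \<open>t\<close>.\<close>
  have approx1: "approximates (\<lambda>k. rat_val v (\<Xi> p1 \<xi> 1 k)) (\<alpha> i) (\<alpha>1 i)" if "i < m" for i \<xi>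
  proof (rule approximates_perturbation[OF \<alpha>12[OF that]])
    show "\<Xi> p1 \<xi> 1 k j = (if j < p1 then \<xi> j else 0)" if "j < ?N" for k j
      using that by (simp add: \<Xi>_def)
    show "rat_val v (\<Xi> p1 \<xi> 1 k) (t / (1 + t)) = ereal (real k + 1)" for k
      unfolding v_divide' by (simp add: t v_1t_pos \<Xi>_def)
    show "\<alpha> i - \<alpha>1 i = t / (1 + t) * (\<alpha>2 i - \<alpha>1 i)"
    proof -
      have "\<alpha> i - \<alpha>1 i = (\<alpha>1 i + t * \<alpha>2 i - (1 + t) * \<alpha>1 i) / (1 + t)"
        using that \<open>1 + t \<noteq> 0\<close> by (simp add: \<alpha>_def diff_divide_distrib)
      then show ?thesis
        by (simp add: algebra_simps)
    qed
  qed
  \<comment> \<open>Now \<open>t\<close> dominates \<open>1 + t\<close>, which has valuation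
    \<open>-(k + 1)\<close>. The small factor is \<open>1 / (1 + t)\<close>, and the two maps
    exchange roles.\<close>
  have approx2: "approximates (\<lambda>k. rat_val v (\<Xi> p2 \<xi> (-1) k)) (\<alpha> i) (\<alpha>2 i)" if "i < m" for i \<xi>
  proof (rule approximates_perturbation[OF \<alpha>12(2,1)[OF that]])
    show "\<Xi> p2 \<xi> (-1) k j = (if j < p2 then \<xi> j else 0)" if "j < ?N" for k j
      using that by (simp add: \<Xi>_def)
    show "rat_val v (\<Xi> p2 \<xi> (-1) k) (1 / (1 + t)) = ereal (real k + 1)" for k
      unfolding v_divide' by (simp add: val1 v_1t_neg \<Xi>_def)
    show "\<alpha> i - \<alpha>2 i = 1 / (1 + t) * (\<alpha>1 i - \<alpha>2 i)"
    proof -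
      have "\<alpha> i - \<alpha>2 i = (\<alpha>1 i + t * \<alpha>2 i - (1 + t) * \<alpha>2 i) / (1 + t)"
        using that \<open>1 + t \<noteq> 0\<close> by (simp add: \<alpha>_def diff_divide_distrib)
      then show ?thesis
        by (simp add: algebra_simps)
    qed
  qed
  \<comment> \<open>One point suffices, here the origin: the finite valuation of
    \<open>subst_poly \<alpha>1 a\<close> is eventually attained by
    \<open>subst_poly \<alpha> a\<close>, which excludes \<open>0\<close>.\<close>
  have nz: "subst_poly \<alpha> a \<noteq> 0" if a: "a \<in> polys m" "a \<noteq> 0" for a
  proof
    assume zero: "subst_poly \<alpha> a = 0"
    have "\<forall>\<^sub>F k in sequentially. rat_val v (\<Xi> p1 (\<lambda>_. 0) 1 k) (subst_poly \<alpha> a) = rat_val v (\<lambda>_. 0) (subst_poly \<alpha>1 a)"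
      using a(1) approx1 \<alpha>1 nz1[OF a]
      by (rule eventually_rat_val_subst_poly) (auto simp: \<Xi>_def)
    then have "rat_val v (\<lambda>_. 0) (subst_poly \<alpha>1 a) = \<infinity>"
      unfolding zero by (simp add: valued_field.v_0[OF valued_field_rat_val])
    then show False
      using nz1[OF a] valued_field.eq_PInfty_iff[OF valued_field_rat_val] by blast
  qed
  have "rational_map (?N + 1) m \<alpha>"
    unfolding rational_map_def
  proof (rule PiE_I)
    fix i assume i: "i \<in> {..<m}"
    \<comment> \<open>That the components of \<open>\<alpha>\<close> are non-zero is the case of
      \<open>nz\<close> in which the polynomial is a single variable.\<close>
    let ?X = "Poly_Mapping.single (Poly_Mapping.single i 1) 1 :: 'k mpoly"
    have "?X \<in> polys m" "?X \<noteq> 0"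
      using i by (auto intro!: polys_single simp flip: keys_eq_empty)
    then have "subst_poly \<alpha> ?X \<noteq> 0"
      by (rule nz)
    then have "\<alpha> i \<noteq> 0"
      by (simp add: subst_poly.hom_1 monom_val_def)
    then show "\<alpha> i \<in> ratfuns (?N + 1) - {0}"
      using \<alpha>_rat i by simp
  qed (simp add: \<alpha>_def)
  then have "dominant_map (?N + 1) m \<alpha> (torus m)"
    by (rule dominant_mapI) (rule nz)
  moreover have \<phi>: "rational_map m n \<phi>"
    using assms(3) by (simp add: dominant_map_def)
  have "im_trop v p1 n (rational_comp m n \<phi> \<alpha>1) \<subseteq> im_trop v (?N + 1) n (rational_comp m n \<phi> \<alpha>)"
  proof (rule im_trop_subset[OF \<phi> \<alpha>_rat nz \<alpha>1 nz1])
    show "\<exists>\<Xi>. (\<forall>k. \<forall>i<p1. \<Xi> k i = \<xi> i) \<and> (\<forall>i<m. approximates (\<lambda>k. rat_val v (\<Xi> k)) (\<alpha> i) (\<alpha>1 i))" for \<xi>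
      by (rule exI[of _ "\<Xi> p1 \<xi> 1"]) (use approx1 in \<open>simp add: \<Xi>_def\<close>)
  qed
  moreover have "im_trop v p2 n (rational_comp m n \<phi> \<alpha>2) \<subseteq> im_trop v (?N + 1) n (rational_comp m n \<phi> \<alpha>)"
  proof (rule im_trop_subset[OF \<phi> \<alpha>_rat nz \<alpha>2 nz2])
    show "\<exists>\<Xi>. (\<forall>k. \<forall>i<p2. \<Xi> k i = \<xi> i) \<and> (\<forall>i<m. approximates (\<lambda>k. rat_val v (\<Xi> k)) (\<alpha> i) (\<alpha>2 i))" for \<xi>
      by (rule exI[of _ "\<Xi> p2 \<xi> (-1)"]) (use approx2 in \<open>simp add: \<Xi>_def\<close>)
  qed
  ultimately show ?thesis
    by blast
qed

end
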